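(* Let $\mathbf{v}=v_1v_2\dots$ be an aperiodic infinite word over a finite set of integers and let $r$ be a real number satisfying $0<r<1$. Then the sequence $(t_{-r}(T^n\mathbf{v}))_{n\ge0}$ is contained in an interval of $\mathbb{R}$ of length $r+r^2-r^3$ if and only if there exist $g\in\mathbb{Z}$ and $\mathbf{w}=w_1w_2\dots\in\mathcal{D}$ such that $v_i=-g+w_i$ for all $i\ge1$. In this case, the endpoints of the interval are $$\frac{gr}{1+r}+t_{-r}(100D\mathbf{c}_\theta),\qquad \frac{gr}{1+r}+t_{-r}(011D\mathbf{c}_\theta),$$ where $\theta$ denotes the slope of $\mathbf{w}$, and the sequence is contained in a semiopen interval with these endpoints. Furthermore, in this case, the sequence is contained in the open interval with these endpoints if and only if $\mathbf{w}\notin\mathcal{C}$.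
   Context: Infinite words are sequences $\mathbf{w}=w_1w_2\dots$ indexed from $1$. An infinite word $w_1w_2\dots$ is aperiodic if there do not exist integers $k,N\ge1$ such that $w_n=w_{n+k}$ for all $n\ge N$. The slope of an infinite word $w_1w_2\dots$ over $\mathbb{Z}$ is $\lim_{n\to\infty}\frac1n\sum_{i=1}^nw_i$. An infinite word $s_1s_2\dots$ over $\{0,1\}$ is Sturmian if there exist an irrational $\theta\in(0,1)$ and $\rho\in\mathbb{R}$ such that either $s_n=\lfloor(n+1)\theta+\rho\rfloor-\lfloor n\theta+\rho\rfloor$ for all $n\ge1$, or $s_n=\lceil(n+1)\theta+\rho\rceil-\lceil n\theta+\rho\rceil$ for all $n\ge1$; it then has slope $\theta$. For irrational $\theta\in(0,1)$, the characteristic Sturmian word $\mathbf{c}_\theta=c_1c_2\dots$ is given by $c_n=\lfloor(n+1)\theta\rfloor-\lfloor n\theta\rfloor$, $n\ge1$. For $\mathbf{w}=w_1w_2\dots$, put $D\mathbf{w}=w_1w_1w_2w_2\dots$ and $T\mathbf{w}=w_2w_3\dots$. For a letter $a$, $a^l$ is the word $a\cdots a$ of length $l$; juxtaposition is concatenation. $\mathcal{D}$ is the set of infinite words over $\{0,1\}$ of the form $0^l(D\mathbf{s})$ or $1^l(D\mathbf{s})$, where $l\ge0$ and $\mathbf{s}$ is a Sturmian word. (Such a word has the same slope as $\mathbf{s}$.) $\mathcal{C}$ is the subset of those $\mathbf{w}\in\mathcal{D}$ such that $T^n\mathbf{w}$ equals $011(D\mathbf{c})$ or $100(D\mathbf{c})$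 for some $n\ge0$ and some characteristic Sturmian word $\mathbf{c}$. For a word $\mathbf{w}=w_1w_2\dots$ over a finite set of integers and real $r$ with $|r|<1$, $t_r(\mathbf{w})=\sum_{i=1}^\infty w_ir^i$ (so $t_{-r}(\mathbf{w})=\sum_{i\ge1}w_i(-r)^i$). *)

theory Defs
  imports "HOL-Analysis.Analysis" "HOL-Library.Omega_Words_Fun"
begin

text \<open>
  Infinite words are functions on \<open>nat\<close>, so that \<open>w i\<close> is the letter \<open>w\<^sub>i\<^sub>+\<^sub>1\<close> of the
  word \<open>w\<^sub>1w\<^sub>2\<dots>\<close>. The iterated shift \<open>T\<^sup>nw\<close> is \<^const>\<open>suffix\<close>, and concatenation
  of a finite and an infinite word is \<^const>\<open>conc\<close>.
\<close>

definition aperiodic :: "int word \<Rightarrow> bool" where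
  "aperiodic w \<longleftrightarrow> \<not> (\<exists>k\<ge>1. \<exists>N. \<forall>n\<ge>N. w n = w (n + k))"

definition slope :: "int word \<Rightarrow> real" where
  "slope w = lim (\<lambda>n. (\<Sum>i<n. real_of_int (w i)) / real n)"

text \<open>The arguments \<open>n + 1\<close> and \<open>n + 2\<close> below account for the shifted indexing.\<close>

definition sturmian :: "int word \<Rightarrow> bool" where
  "sturmian s \<longleftrightarrow> range s \<subseteq> {0, 1} \<and>
     (\<exists>\<theta> \<rho> :: real. 0 < \<theta> \<and> \<theta> < 1 \<and> \<theta> \<notin> \<rat> \<and>
        ((\<forall>n. s n = \<lfloor>real (n + 2) * \<theta> + \<rho>\<rfloor> - \<lfloor>real (n + 1) * \<theta> + \<rho>\<rfloor>) \<or>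
         (\<forall>n. s n = \<lceil>real (n + 2) * \<theta> + \<rho>\<rceil> - \<lceil>real (n + 1) * \<theta> + \<rho>\<rceil>)))"

definition char_word :: "real \<Rightarrow> int word" where
  "char_word \<theta> = (\<lambda>n. \<lfloor>real (n + 2) * \<theta>\<rfloor> - \<lfloor>real (n + 1) * \<theta>\<rfloor>)"

definition doubling :: "'a word \<Rightarrow> 'a word" where
  "doubling w = (\<lambda>n. w (n div 2))"

definition class_D :: "int word set" where
  "class_D = {w. \<exists>l s. sturmian s \<and>
     (w = replicate l 0 \<frown> doubling s \<or> w = replicate l 1 \<frown> doubling s)}"

definition class_C :: "int word set" where
  "class_C = {w \<in> class_D. \<exists>n \<theta>. 0 < \<theta> \<and> \<theta> < 1 \<and> \<theta> \<notin> \<rat> \<and>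
     (suffix n w = [0, 1, 1] \<frown> doubling (char_word \<theta>) \<or>
      suffix n w = [1, 0, 0] \<frown> doubling (char_word \<theta>))}"

definition word_series :: "real \<Rightarrow> int word \<Rightarrow> real" where
  "word_series r w = (\<Sum>i. real_of_int (w i) * r ^ (i + 1))"

definition interval_with_endpoints :: "real \<Rightarrow> real \<Rightarrow> real set \<Rightarrow> bool" where
  "interval_with_endpoints a b I \<longleftrightarrow>
     a < b \<and> (I = {a<..<b} \<or> I = {a..<b} \<or> I = {a<..b} \<or> I = {a..b})"

end

theory Submission
  imports Defs
begin

text \<open>
  Write \<open>t n\<close> for the value of the \<open>n\<close>-th shift and \<open>L = r + r\<^sup>2 - r\<^sup>3 < 1\<close>. If all differences
  \<open>t m - t n\<close> are at most \<open>L\<close>, then \<open>t n = - r (v n + t (n + 1))\<close> and aperiodicity leave room for two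
  consecutive letters only, say \<open>0\<close> and \<open>1\<close>. Comparing an occurrence of \<open>01\<close> with one of \<open>10\<close>
  shows that they continue as \<open>011x\<close> and \<open>100y\<close>, with the value of \<open>x\<close> at least that of \<open>y\<close>;
  an infinite descent then excludes runs of odd length after the initial run, so that a suffix is
  of the form \<open>D s\<close>. Since the value of \<open>D s\<close> in base \<open>- r\<close> is a negative multiple of the value of \<open>s\<close>
  in base \<open>r\<^sup>2\<close>, the same comparison makes \<open>s\<close> balanced, hence Sturmian.

  Conversely, every sum of \<open>k\<close> consecutive letters of a Sturmian word of slope \<open>\<theta>\<close> is
  \<open>\<lfloor>k \<theta>\<rfloor>\<close> or \<open>\<lfloor>k \<theta>\<rfloor> + 1\<close>. By Abel summation the values in base \<open>r\<^sup>2\<close> are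
  monotone in these sums, so they lie between those of \<open>0c\<close> and \<open>1c\<close>, with equality only for these
  two words; the extremal prefixes occur at positions of almost extremal discrepancy.
\<close>

section \<open>Word series\<close>

lemma summable_word_series:
  fixes x :: real
  assumes "finite (range w)" "\<bar>x\<bar> < 1"
  shows "summable (\<lambda>i. real_of_int (w i) * x ^ (i + 1))"
proof -
  obtain C where C: "\<And>i. \<bar>real_of_int (w i)\<bar> \<le> C"
  proof -
    have "finite (range (\<lambda>i. \<bar>real_of_int (w i)\<bar>))"
      using finite_imageI[OF assms(1), of "\<lambda>a. \<bar>real_of_int a\<bar>"] by (simp add: image_image)
    then have "\<bar>real_of_int (w i)\<bar> \<le> Max (range (\<lambda>i. \<bar>real_of_int (w i)\<bar>))" for i
      by (intro Max_ge) auto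
    then show ?thesis using that by blast
  qed
  show ?thesis
  proof (rule summable_comparison_test')
    show "summable (\<lambda>i. (C * \<bar>x\<bar>) * \<bar>x\<bar> ^ i)"
      using assms(2) by (intro summable_mult summable_geometric) auto
    show "norm (real_of_int (w i) * x ^ (i + 1)) \<le> (C * \<bar>x\<bar>) * \<bar>x\<bar> ^ i" for i
      using C[of i] by (simp add: abs_mult power_abs mult.assoc mult_right_mono)
  qed
qed

lemma finite_range_suffix: "finite (range w) \<Longrightarrow> finite (range (suffix n w))"
  by (rule finite_subset[of _ "range w"]) auto

lemma finite_range_binary: "range w \<subseteq> {0, 1 :: int} \<Longrightarrow> finite (range w)"
  by (rule finite_subset) auto

lemma word_series_Cons:
  assumes "finite (range w)" "\<bar>x\<bar> < 1"
  shows "word_series x w = x * (real_of_int (w 0) + word_series x (suffix 1 w))"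
proof -
  have "word_series x (suffix 1 w) * x = (\<Sum>i. real_of_int (w (Suc i)) * x ^ (Suc i + 1))"
    unfolding word_series_def
    using suminf_mult2[OF summable_word_series[OF finite_range_suffix[OF assms(1)] assms(2)], of 1 x]
    by (simp add: mult_ac)
  moreover have "word_series x w = real_of_int (w 0) * x +
      (\<Sum>i. real_of_int (w (Suc i)) * x ^ (Suc i + 1))"
    unfolding word_series_def
    using suminf_split_head[OF summable_word_series[OF assms]] by simp
  ultimately show ?thesis by (simp add: algebra_simps)
qed

lemma word_series_suffix:
  assumes "finite (range w)" "\<bar>x\<bar> < 1"
  shows "word_series x (suffix n w) =
    x * (real_of_int (w n) + word_series x (suffix (Suc n) w))"
  using word_series_Cons[OF finite_range_suffix[OF assms(1)] assms(2), of n] by simp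

text \<open>One constant word \<open>u\<close> dominates all shifts at once. The contraction
  argument for doubled words needs a bound independent of \<open>n\<close>.\<close>

lemma word_series_suffix_bounded:
  assumes "finite (range w)" "\<bar>x\<bar> < 1"
  obtains C where "\<And>n. \<bar>word_series x (suffix n w)\<bar> \<le> C"
proof -
  have fin: "finite (range (\<lambda>i. \<bar>w i\<bar>))"
    using finite_imageI[OF assms(1), of abs] by (simp add: image_image)
  define u :: "int word" where "u = (\<lambda>i. Max (range (\<lambda>i. \<bar>w i\<bar>)))"
  have u: "\<bar>w i\<bar> \<le> u j" for i j
    unfolding u_def using fin by (intro Max_ge) auto
  have fu: "finite (range u)" by (simp add: u_def)
  show ?thesis
  proof
    fix n
    have s1: "summable (\<lambda>i. real_of_int (u i) * \<bar>x\<bar> ^ (i + 1))"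
      using assms(2) by (intro summable_word_series fu) auto
    have le: "norm (real_of_int (suffix n w i) * x ^ (i + 1)) \<le> real_of_int (u i) * \<bar>x\<bar> ^ (i + 1)" for i
    proof -
      have "\<bar>real_of_int (suffix n w i)\<bar> \<le> real_of_int (u i)"
        using u[of "n + i" i] by (simp flip: of_int_abs)
      then show ?thesis unfolding real_norm_def abs_mult power_abs by (intro mult_right_mono) auto
    qed
    have "norm (\<Sum>i. real_of_int (suffix n w i) * x ^ (i + 1)) \<le> (\<Sum>i. real_of_int (u i) * \<bar>x\<bar> ^ (i + 1))"
      by (rule norm_suminf_le[OF le s1])
    then show "\<bar>word_series x (suffix n w)\<bar> \<le> word_series \<bar>x\<bar> u"
      by (simp add: word_series_def)
  qed
qed

text \<open>Common letters cancel, so \<open>k\<close> of them only scale the difference of the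
  tails by \<open>x ^ k\<close>. In base \<open>- r\<close> the sign of this factor is the parity of
  \<open>k\<close>.\<close>

lemma word_series_diff:
  assumes "finite (range w)" "finite (range u)" "\<bar>x\<bar> < 1"
    and "\<And>i. i < k \<Longrightarrow> w (m + i) = u (n + i)"
  shows "word_series x (suffix m w) - word_series x (suffix n u) =
    x ^ k * (word_series x (suffix (m + k) w) - word_series x (suffix (n + k) u))"
  using assms(4)
proof (induction k)
  case (Suc k)
  then have "word_series x (suffix m w) - word_series x (suffix n u) =
    x ^ k * (word_series x (suffix (m + k) w) - word_series x (suffix (n + k) u))"
    by (intro Suc.IH) simp
  also have "word_series x (suffix (m + k) w) - word_series x (suffix (n + k) u) =
    x * (word_series x (suffix (m + Suc k) w) - word_series x (suffix (n + Suc k) u))"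
    using Suc.prems[of k] word_series_suffix[OF assms(1,3), of "m + k"]
      word_series_suffix[OF assms(2,3), of "n + k"] by (simp only: add_Suc_right) (simp add: algebra_simps)
  finally show ?case by (simp only: power_Suc2 mult.assoc)
qed simp

lemma word_series_add_const:
  assumes "finite (range w)" "\<bar>x\<bar> < 1"
  shows "word_series x (\<lambda>i. c + w i) = real_of_int c * x / (1 - x) + word_series x w"
proof -
  have "(\<lambda>i. (real_of_int c * x) * x ^ i) sums ((real_of_int c * x) * (1 / (1 - x)))"
    using assms(2) by (intro sums_mult geometric_sums) auto
  from sums_add[OF this summable_sums[OF summable_word_series[OF assms]]]
  have "(\<lambda>i. real_of_int (c + w i) * x ^ (i + 1)) sums
      (real_of_int c * x / (1 - x) + word_series x w)"
    by (simp add: word_series_def algebra_simps)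
  then show ?thesis by (simp add: word_series_def sums_iff)
qed

lemma word_series_uminus:
  assumes "finite (range w)" "\<bar>x\<bar> < 1"
  shows "word_series x (\<lambda>i. - w i) = - word_series x w"
  using suminf_minus[OF summable_word_series[OF assms]] by (simp add: word_series_def)

lemma word_series_binary_bounds:
  assumes "range w \<subseteq> {0, 1}" "0 \<le> x" "x < 1"
  shows "0 \<le> word_series x w" "word_series x w \<le> x / (1 - x)"
proof -
  have s: "summable (\<lambda>i. real_of_int (w i) * x ^ (i + 1))"
    using assms by (intro summable_word_series finite_range_binary) auto
  have w: "w i = 0 \<or> w i = 1" for i using assms(1) by auto
  have w': "0 \<le> real_of_int (w i)" "real_of_int (w i) \<le> 1" for i using w[of i] by auto
  have g: "(\<lambda>i. x * x ^ i) sums (x * (1 / (1 - x)))"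
    using assms by (intro sums_mult geometric_sums) auto
  show "0 \<le> word_series x w" unfolding word_series_def
    using w' assms(2) by (intro suminf_nonneg s mult_nonneg_nonneg) auto
  have "(\<Sum>i. real_of_int (w i) * x ^ (i + 1)) \<le> (\<Sum>i. x * x ^ i)"
    using w' assms(2) g mult_right_mono[OF w'(2), of "x ^ (_ + 1)"]
    by (intro suminf_le s) (auto simp: sums_iff)
  then show "word_series x w \<le> x / (1 - x)"
    using g by (simp add: word_series_def sums_iff)
qed

section \<open>Doubled words: from base \<open>- r\<close> to base \<open>r\<^sup>2\<close>\<close>

lemma bounded_contraction_zero:
  fixes E :: "nat \<Rightarrow> real"
  assumes "\<And>j. E j = c * E (Suc j)" "\<And>j. \<bar>E j\<bar> \<le> C" "\<bar>c\<bar> < 1"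
  shows "E j = 0"
proof -
  have *: "E j = c ^ k * E (j + k)" for k
  proof (induction k)
    case (Suc k)
    then show ?case using assms(1)[of "j + k"] by (simp add: mult_ac)
  qed simp
  have "(\<lambda>k. \<bar>c\<bar> ^ k * C) \<longlonglongrightarrow> 0 * C"
    using assms(3) by (intro tendsto_mult LIMSEQ_power_zero tendsto_const) auto
  moreover have "\<bar>E j\<bar> \<le> \<bar>c\<bar> ^ k * C" for k
    using assms(2)[of "j + k"] by (simp add: *[of k] abs_mult power_abs mult_left_mono)
  ultimately have "\<bar>E j\<bar> \<le> 0" by (intro LIMSEQ_le_const) auto
  then show ?thesis by simp
qed

lemma suffix_doubling: "suffix (2 * j) (doubling s) = doubling (suffix j s)"
  by (auto simp: doubling_def suffix_def)

lemma range_doubling: "range (doubling s) = range s"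
proof -
  have "s n \<in> range (doubling s)" for n
    using rangeI[of "doubling s" "2 * n"] by (simp add: doubling_def)
  then show ?thesis by (auto simp: doubling_def)
qed

text \<open>The two copies of a letter contribute it
  \<open>- r + r\<^sup>2 = - ((1 - r) / r) * r\<^sup>2\<close> times, up to a power of
  \<open>r\<^sup>2\<close>. Instead of regrouping the series, the proof shows that the difference
  \<open>E j\<close> of both sides for the \<open>j\<close>-th shift is bounded and satisfies
  \<open>E j = r\<^sup>2 * E (Suc j)\<close>, hence vanishes.\<close>

lemma word_series_doubling:
  assumes "finite (range s)" "0 < r" "r < 1"
  shows "word_series (- r) (doubling s) = - ((1 - r) / r) * word_series (r\<^sup>2) s"
proof -
  define E where "E j = word_series (- r) (suffix (2 * j) (doubling s))
    + (1 - r) / r * word_series (r\<^sup>2) (suffix j s)" for j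
  have q: "\<bar>r\<^sup>2\<bar> < 1" using assms by (simp add: power_less_one_iff abs_square_less_1)
  have fd: "finite (range (doubling s))" using assms(1) by (simp add: range_doubling)
  obtain C1 where C1: "\<bar>word_series (- r) (suffix n (doubling s))\<bar> \<le> C1" for n
    using word_series_suffix_bounded[OF fd, of "- r"] assms by auto
  obtain C2 where C2: "\<bar>word_series (r\<^sup>2) (suffix n s)\<bar> \<le> C2" for n
    using word_series_suffix_bounded[OF assms(1) q] by auto
  have "E 0 = 0"
  proof (rule bounded_contraction_zero)
    show "\<bar>r\<^sup>2\<bar> < 1" by (rule q)
    fix j
    have "word_series (- r) (suffix (2 * j) (doubling s)) =
      - r * (s j + (- r) * (s j + word_series (- r) (suffix (2 * Suc j) (doubling s))))"
      using assms word_series_suffix[OF fd, of "- r" "2 * j"]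
        word_series_suffix[OF fd, of "- r" "2 * j + 1"]
      by (simp add: doubling_def)
    moreover have "word_series (r\<^sup>2) (suffix j s) = r\<^sup>2 * (s j + word_series (r\<^sup>2) (suffix (Suc j) s))"
      by (rule word_series_suffix[OF assms(1) q])
    moreover have "(1 - r) / r * r\<^sup>2 = (1 - r) * r" using assms by (simp add: power2_eq_square)
    then have "(1 - r) / r * (r\<^sup>2 * real_of_int (s j)) = (1 - r) * r * real_of_int (s j)"
      by (simp only: mult.assoc[symmetric])
    ultimately show "E j = r\<^sup>2 * E (Suc j)"
      by (simp only: E_def distrib_left) (simp add: algebra_simps power2_eq_square)
    have "\<bar>(1 - r) / r * word_series (r\<^sup>2) (suffix j s)\<bar> \<le> (1 - r) / r * C2"
      using mult_left_mono[OF C2[of j], of "(1 - r) / r"] assms by (simp add: abs_mult)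
    then show "\<bar>E j\<bar> \<le> C1 + (1 - r) / r * C2"
      unfolding E_def using C1[of "2 * j"] by linarith
  qed
  then show ?thesis by (simp add: E_def)
qed

section \<open>Abel summation and comparison by partial sums\<close>

lemma sum_binary_bounds:
  fixes s :: "int word"
  assumes "range s \<subseteq> {0, 1}"
  shows "0 \<le> (\<Sum>i<k. s (n + i))" "(\<Sum>i<k. s (n + i)) \<le> int k"
proof -
  have s: "s i = 0 \<or> s i = 1" for i using assms by auto
  have s': "0 \<le> s i" "s i \<le> 1" for i using s[of i] by auto
  show "0 \<le> (\<Sum>i<k. s (n + i))" using s' by (intro sum_nonneg) auto
  have "(\<Sum>i<k. s (n + i)) \<le> (\<Sum>i<k. 1)" using s' by (intro sum_mono) auto
  then show "(\<Sum>i<k. s (n + i)) \<le> int k" by simp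
qed

lemma summable_partial_sums:
  fixes s :: "int word" and x :: real
  assumes "range s \<subseteq> {0, 1}" "0 < x" "x < 1"
  shows "summable (\<lambda>k. (\<Sum>i<k. real_of_int (s i)) * x ^ k)"
proof (rule summable_comparison_test')
  show "summable (\<lambda>k. real k * x ^ k)"
  proof -
    have "(\<lambda>n. real (Suc n) * x ^ n * x) sums (1 / (1 - x)\<^sup>2 * x)"
      using assms by (intro sums_mult2 geometric_deriv_sums) auto
    then have "summable (\<lambda>n. real (Suc n) * x ^ Suc n)"
      by (simp only: sums_summable power_Suc2 mult.assoc)
    then show ?thesis by (rule iffD1[OF summable_Suc_iff])
  qed
  fix k
  have "0 \<le> real_of_int (\<Sum>i<k. s i)" "real_of_int (\<Sum>i<k. s i) \<le> real_of_int (int k)"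
    using sum_binary_bounds[OF assms(1), where n = 0 and k = k] by (simp_all only: add_0 of_int_0_le_iff of_int_le_iff)
  then show "norm ((\<Sum>i<k. real_of_int (s i)) * x ^ k) \<le> real k * x ^ k"
    using assms(2) by (simp add: abs_mult)
qed

lemma word_series_partial_sums:
  fixes s :: "int word" and x :: real
  assumes "range s \<subseteq> {0, 1}" "0 < x" "x < 1"
  shows "word_series x s = (1 - x) * (\<Sum>k. (\<Sum>i<k. real_of_int (s i)) * x ^ k)"
proof -
  let ?S = "\<lambda>k. (\<Sum>i<k. real_of_int (s i)) * x ^ k"
  have sm: "summable ?S" by (rule summable_partial_sums[OF assms])
  have "(\<lambda>k. ?S (Suc k)) sums suminf ?S"
    using suminf_split_head[OF sm] summable_sums[OF iffD2[OF summable_Suc_iff sm]] by simp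
  moreover have "(\<lambda>k. x * ?S k) sums (x * suminf ?S)"
    by (intro sums_mult summable_sums sm)
  ultimately have "(\<lambda>k. ?S (Suc k) - x * ?S k) sums (suminf ?S - x * suminf ?S)"
    by (rule sums_diff)
  moreover have "(\<lambda>k. ?S (Suc k) - x * ?S k) = (\<lambda>k. real_of_int (s k) * x ^ (k + 1))"
    by (auto simp: algebra_simps)
  ultimately have "(\<lambda>k. real_of_int (s k) * x ^ (k + 1)) sums (suminf ?S - x * suminf ?S)"
    by (simp only:)
  then have "word_series x s = suminf ?S - x * suminf ?S"
    unfolding word_series_def by (rule sums_unique[symmetric])
  then show ?thesis by (simp only: left_diff_distrib mult_1)
qed

text \<open>By Abel summation each partial sum enters with the positive weight
  \<open>(1 - x) * x ^ k\<close>. Equal values therefore force all partial sums, and so all letters,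
  to agree.\<close>

lemma word_series_mono:
  fixes s u :: "int word" and x :: real
  assumes "range s \<subseteq> {0, 1}" "range u \<subseteq> {0, 1}" "0 < x" "x < 1"
    and le: "\<And>k. (\<Sum>i<k. s i) \<le> (\<Sum>i<k. u i)"
  shows "word_series x s \<le> word_series x u"
    and "word_series x s = word_series x u \<Longrightarrow> s = u"
proof -
  let ?S = "\<lambda>k. (\<Sum>i<k. real_of_int (s i)) * x ^ k"
  let ?U = "\<lambda>k. (\<Sum>i<k. real_of_int (u i)) * x ^ k"
  have S: "summable ?S" "summable ?U" using assms by (simp_all only: summable_partial_sums[OF assms(1,3,4)] summable_partial_sums[OF assms(2,3,4)])
  have le': "0 \<le> ?U k - ?S k" for k
  proof -
    have "(\<Sum>i<k. real_of_int (s i)) \<le> (\<Sum>i<k. real_of_int (u i))"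
      using le[of k] by (simp only: of_int_sum[symmetric] of_int_le_iff)
    then show ?thesis using assms(3) by (simp add: mult_right_mono)
  qed
  have d: "summable (\<lambda>k. ?U k - ?S k)" by (intro summable_diff S)
  have e: "word_series x u - word_series x s = (1 - x) * (\<Sum>k. ?U k - ?S k)"
    by (simp only: word_series_partial_sums[OF assms(1,3,4)] word_series_partial_sums[OF assms(2,3,4)]
        suminf_diff[OF S(2,1), symmetric] right_diff_distrib)
  have "0 \<le> (\<Sum>k. ?U k - ?S k)" by (rule suminf_nonneg[OF d le'])
  then have "0 \<le> (1 - x) * (\<Sum>k. ?U k - ?S k)" using assms(4) by (intro mult_nonneg_nonneg) simp_all
  then show "word_series x s \<le> word_series x u" using e by linarith
  assume "word_series x s = word_series x u"
  then have "(1 - x) * (\<Sum>k. ?U k - ?S k) = 0" using e by linarith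
  then have "(\<Sum>k. ?U k - ?S k) = 0" using assms(4) by simp
  then have US: "?U k - ?S k = 0" for k
    by (rule spec[OF iffD1[OF suminf_eq_zero_iff[OF d le']]])
  have eq: "(\<Sum>i<k. real_of_int (u i)) = (\<Sum>i<k. real_of_int (s i))" for k
  proof -
    have "((\<Sum>i<k. real_of_int (u i)) - (\<Sum>i<k. real_of_int (s i))) * x ^ k = 0"
      using US[of k] by (simp only: left_diff_distrib)
    then show ?thesis using assms(3) by simp
  qed
  have "real_of_int (s k) = real_of_int (u k)" for k
    using eq[of k] eq[of "Suc k"] by simp
  then show "s = u" by auto
qed

section \<open>Balanced words\<close>

definition factor_sum :: "int word \<Rightarrow> nat \<Rightarrow> nat \<Rightarrow> int" where
  "factor_sum s n k = (\<Sum>i<k. s (n + i))"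

text \<open>The bound is one on the absolute difference, because \<open>m\<close> and
  \<open>n\<close> may be exchanged.\<close>

definition balanced :: "int word \<Rightarrow> bool" where
  "balanced s \<longleftrightarrow> (\<forall>m n k. factor_sum s m k - factor_sum s n k \<le> 1)"

lemma factor_sum_0 [simp]: "factor_sum s n 0 = 0"
  by (simp add: factor_sum_def)

lemma factor_sum_Suc: "factor_sum s n (Suc k) = factor_sum s n k + s (n + k)"
  by (simp add: factor_sum_def)

lemma factor_sum_add: "factor_sum s n (j + k) = factor_sum s n j + factor_sum s (n + j) k"
  by (induction k) (simp_all add: factor_sum_Suc add_ac)

lemma factor_sum_Suc_left: "factor_sum s n (Suc k) = s n + factor_sum s (Suc n) k"
  using factor_sum_add[of s n 1 k] by (simp add: factor_sum_def)

lemma factor_sum_mult: "factor_sum s n (j * k) = (\<Sum>i<j. factor_sum s (n + i * k) k)"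
proof (induction j)
  case (Suc j)
  have "factor_sum s n (Suc j * k) = factor_sum s n (j * k + k)" by (simp add: add.commute)
  then show ?case using Suc by (simp add: factor_sum_add)
qed simp

section \<open>Aperiodicity\<close>

lemma aperiodic_not_eventually_const:
  assumes "aperiodic w"
  shows "\<exists>n\<ge>N. w n \<noteq> a"
proof (rule ccontr)
  assume "\<not> ?thesis"
  then have "\<forall>n\<ge>N. w n = w (n + 1)" by simp
  then show False using assms unfolding aperiodic_def by (metis le_refl)
qed

lemma aperiodic_suffix: "aperiodic w \<Longrightarrow> aperiodic (suffix n w)"
proof (unfold aperiodic_def, elim contrapos_nn exE conjE)
  fix k N assume k: "1 \<le> k" "\<forall>m\<ge>N. suffix n w m = suffix n w (m + k)"
  have "w m = w (m + k)" if "n + N \<le> m" for m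
    using k(2)[rule_format, of "m - n"] that by simp
  then show "\<exists>k\<ge>1. \<exists>N. \<forall>m\<ge>N. w m = w (m + k)" using k(1) by blast
qed

lemma aperiodic_doublingD: "aperiodic (doubling s) \<Longrightarrow> aperiodic s"
proof (unfold aperiodic_def, elim contrapos_nn exE conjE)
  fix k N assume k: "1 \<le> k" "\<forall>m\<ge>N. s m = s (m + k)"
  have *: "doubling s m = doubling s (m + 2 * k)" if "2 * N \<le> m" for m
    using k(2)[rule_format, of "m div 2"] that by (simp add: doubling_def add.commute)
  have "1 \<le> 2 * k" using k(1) by simp
  with * show "\<exists>k\<ge>1. \<exists>N. \<forall>m\<ge>N. doubling s m = doubling s (m + k)" by blast
qed

text \<open>Two nonzero values of \<open>g\<close> in one residue class modulo \<open>k\<close>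
  would give a sum of at least 2 along that class. So each of the \<open>k\<close> classes contains
  at most one.\<close>

lemma nonneg_eventually_zero:
  fixes g :: "nat \<Rightarrow> int"
  assumes "1 \<le> k" "\<And>n. 0 \<le> g n" "\<And>n j. (\<Sum>i<j. g (n + i * k)) \<le> 1"
  shows "\<exists>N. \<forall>n\<ge>N. g n = 0"
proof -
  have inj: "n = m" if nz: "g n \<noteq> 0" "g m \<noteq> 0" and eq: "n mod k = m mod k" "n \<le> m" for n m
  proof (rule ccontr)
    assume "n \<noteq> m"
    obtain d where d: "m = n + k * d"
      using eq by (metis mod_eq_dvd_iff_nat dvdE le_add_diff_inverse)
    then have "d \<noteq> 0" using \<open>n \<noteq> m\<close> by (intro notI) simp
    then have "(\<Sum>i\<in>{0, d}. g (n + i * k)) \<le> (\<Sum>i<Suc d. g (n + i * k))"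
      using assms(2) by (intro sum_mono2) auto
    moreover have "(\<Sum>i\<in>{0, d}. g (n + i * k)) = g n + g m"
      using \<open>d \<noteq> 0\<close> by (simp add: d mult.commute)
    ultimately show False
      using assms(3)[of n "Suc d"] assms(2)[of n] assms(2)[of m] nz by linarith
  qed
  have "inj_on (\<lambda>n. n mod k) {n. g n \<noteq> 0}"
  proof (rule inj_onI)
    fix n m assume "n \<in> {n. g n \<noteq> 0}" "m \<in> {n. g n \<noteq> 0}" "n mod k = m mod k"
    then show "n = m" using inj[of n m] inj[of m n] by (cases "n \<le> m") simp_all
  qed
  moreover have "(\<lambda>n. n mod k) ` {n. g n \<noteq> 0} \<subseteq> {..<k}" using assms(1) by auto
  ultimately have "finite {n. g n \<noteq> 0}" by (rule inj_on_finite) simp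
  then obtain N where "\<forall>n\<in>{n. g n \<noteq> 0}. n < N" by (meson finite_nat_set_iff_bounded)
  then show ?thesis by (intro exI[of _ N]) force
qed

text \<open>\<open>\<theta>\<close> is the supremum of the lower estimates
  \<open>(factor_sum s n k - 1) / k\<close>. Each of them is at most every upper estimate
  \<open>(factor_sum s n k + 1) / k\<close>, also across positions and lengths.\<close>

lemma balanced_slope:
  assumes "balanced s"
  obtains \<theta> :: real where "\<And>n k. \<bar>real_of_int (factor_sum s n k) - real k * \<theta>\<bar> \<le> 1"
proof -
  have b: "factor_sum s m k - factor_sum s n k \<le> 1" for m n k
    using assms by (auto simp: balanced_def)
  define Z where "Z = {(real_of_int (factor_sum s n k) - 1) / real k |n k. 1 \<le> k}"
  have cmp: "(real_of_int (factor_sum s m j) - 1) / real j \<le> (real_of_int (factor_sum s n k) + 1) / real k"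
    if "1 \<le> j" "1 \<le> k" for m n j k
  proof -
    \<comment> \<open>The block of length \<open>k * j\<close> at \<open>m\<close> is cut once into
      \<open>k\<close> pieces of length \<open>j\<close> and once into \<open>j\<close> pieces of
      length \<open>k\<close>.\<close>
    have "(\<Sum>i<k. factor_sum s m j - 1) \<le> (\<Sum>i<k. factor_sum s (m + i * j) j)"
      using b[of m j] by (intro sum_mono) (simp add: algebra_simps)
    also have "\<dots> = factor_sum s m (k * j)" by (rule factor_sum_mult[symmetric])
    also have "\<dots> = (\<Sum>i<j. factor_sum s (m + i * k) k)"
      by (subst mult.commute) (rule factor_sum_mult)
    also have "\<dots> \<le> (\<Sum>i<j. factor_sum s n k + 1)"
      using b[of _ k n] by (intro sum_mono) (simp add: algebra_simps)
    finally have "int k * (factor_sum s m j - 1) \<le> int j * (factor_sum s n k + 1)" by simp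
    then have "real_of_int (int k * (factor_sum s m j - 1)) \<le> real_of_int (int j * (factor_sum s n k + 1))"
      by (simp only: of_int_le_iff)
    then show ?thesis using that by (simp add: field_simps)
  qed
  have "Z \<noteq> {}" unfolding Z_def by (auto intro: exI[of _ 1])
  have "bdd_above Z"
    using cmp[of _ 1 _ 0] unfolding Z_def by (intro bdd_aboveI) auto
  have "\<bar>real_of_int (factor_sum s n k) - real k * Sup Z\<bar> \<le> 1" for n k
  proof (cases "k = 0")
    case False
    have "(real_of_int (factor_sum s n k) - 1) / real k \<le> Sup Z"
    proof (rule cSup_upper)
      show "(real_of_int (factor_sum s n k) - 1) / real k \<in> Z"
        using False unfolding Z_def by (intro CollectI exI[of _ n] exI[of _ k]) simp
    qed fact
    moreover have "Sup Z \<le> (real_of_int (factor_sum s n k) + 1) / real k"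
      using False cmp \<open>Z \<noteq> {}\<close> by (intro cSup_least) (auto simp: Z_def)
    ultimately show ?thesis using False by (auto simp: abs_le_iff field_simps)
  qed simp
  then show ?thesis by (rule that)
qed

text \<open>If \<open>\<theta> = p / k\<close>, the deviations \<open>g n\<close> of the factor sums
  of length \<open>k\<close> from \<open>p\<close> have sums of absolute value at most 1 along
  progressions of step \<open>k\<close>, and balance excludes that both signs occur. So they vanish
  eventually, which makes \<open>k\<close> an eventual period.\<close>

lemma balanced_aperiodic_slope_irrational:
  assumes "balanced s" "aperiodic s"
    and \<theta>: "\<And>n k. \<bar>real_of_int (factor_sum s n k) - real k * \<theta>\<bar> \<le> 1"
  shows "\<theta> \<notin> \<rat>"
proof
  assume "\<theta> \<in> \<rat>"
  then obtain p :: int and k :: nat where k: "k > 0" "\<theta> = real_of_int p / real k"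
    by (metis Rats_cases' of_int_of_nat_eq pos_int_cases of_nat_0_less_iff)
  define g where "g n = factor_sum s n k - p" for n
  have sum: "\<bar>\<Sum>i<j. g (n + i * k)\<bar> \<le> 1" for n j
  proof -
    have "(\<Sum>i<j. g (n + i * k)) = factor_sum s n (j * k) - int j * p"
      by (simp add: g_def sum_subtractf factor_sum_mult)
    moreover have "\<bar>real_of_int (factor_sum s n (j * k) - int j * p)\<bar> \<le> 1"
      using \<theta>[of n "j * k"] k by simp
    ultimately show ?thesis by linarith
  qed
  have diff: "g m - g n \<le> 1" for m n
    using assms(1) by (auto simp: balanced_def g_def)
  have le1: "\<bar>g n\<bar> \<le> 1" for n using sum[where j = 1 and n = n] by simp
  have "\<exists>N. \<forall>n\<ge>N. g n = 0"
  proof (cases "\<forall>n. 0 \<le> g n")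
    case True
    then show ?thesis
      using sum k by (intro nonneg_eventually_zero[of k g]) (auto simp: abs_le_iff)
  next
    case False
    then obtain m where "g m < 0" using not_le by blast
    then have "0 \<le> - g n" for n using diff[of n m] by linarith
    moreover have "(\<Sum>i<j. - g (n + i * k)) \<le> 1" for n j
      using sum[where n = n and j = j] by (simp add: sum_negf abs_le_iff)
    ultimately have "\<exists>N. \<forall>n\<ge>N. - g n = 0" using k by (intro nonneg_eventually_zero[of k]) auto
    then show ?thesis by simp
  qed
  then obtain N where N: "\<And>n. n \<ge> N \<Longrightarrow> g n = 0" by blast
  have "s n = s (n + k)" if "n \<ge> N" for n
    using N[of n] N[of "Suc n"] that factor_sum_Suc_left[of s n k] factor_sum_Suc[of s n k]
    by (simp add: g_def)
  then show False using assms(2) k unfolding aperiodic_def by (metis Suc_leI One_nat_def)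
qed

text \<open>The discrepancy \<open>U n\<close> of the prefix of length \<open>n\<close> stays
  between \<open>I\<close> and \<open>I + 1\<close>, and irrationality lets at most one of these
  ends be attained. Counting letters is then rounding: a floor if the upper end is attained, a
  ceiling otherwise.\<close>

lemma balanced_aperiodic_imp_sturmian:
  assumes "range s \<subseteq> {0, 1}" "balanced s" "aperiodic s"
  shows "sturmian s"
proof -
  obtain \<theta> :: real where \<theta>: "\<And>n k. \<bar>real_of_int (factor_sum s n k) - real k * \<theta>\<bar> \<le> 1"
    using balanced_slope[OF assms(2)] by blast
  have irr: "\<theta> \<notin> \<rat>" by (rule balanced_aperiodic_slope_irrational[OF assms(2,3) \<theta>])
  have s01: "s n = 0 \<or> s n = 1" for n using assms(1) by auto
  have f: "0 \<le> factor_sum s n k" "factor_sum s n k \<le> int k" for n k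
    using sum_binary_bounds[OF assms(1), where n = n and k = k] by (simp_all add: factor_sum_def)
  \<comment> \<open>Outside the unit interval, \<open>k * \<theta>\<close> would leave the range
    from 0 to \<open>k\<close> of the factor sums by more than 1.\<close>
  have "0 \<le> \<theta>"
  proof (rule ccontr)
    assume "\<not> 0 \<le> \<theta>"
    then obtain k :: nat where "1 < real k * (- \<theta>)" using ex_less_of_nat_mult[of "- \<theta>" 1] by auto
    then show False using \<theta>[of 0 k] f(1)[of 0 k] by (simp add: abs_le_iff)
  qed
  moreover have "\<theta> \<le> 1"
  proof (rule ccontr)
    assume "\<not> \<theta> \<le> 1"
    then obtain k :: nat where "1 < real k * (\<theta> - 1)" using ex_less_of_nat_mult[of "\<theta> - 1" 1] by auto
    moreover have "real_of_int (factor_sum s 0 k) \<le> real k" using f(2)[of 0 k] by linarith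
    ultimately show False using \<theta>[of 0 k] by (simp add: abs_le_iff algebra_simps)
  qed
  ultimately have \<theta>01: "0 < \<theta>" "\<theta> < 1" using irr by (auto simp: less_le)
  define U where "U n = real_of_int (factor_sum s 0 n) - real n * \<theta>" for n
  have Ud: "\<bar>U n - U m\<bar> \<le> 1" for m n
  proof -
    have *: "\<bar>U (m + k) - U m\<bar> \<le> 1" for m k
    proof -
      have "U (m + k) - U m = real_of_int (factor_sum s m k) - real k * \<theta>"
        using factor_sum_add[of s 0 m k] unfolding U_def by (simp add: distrib_right)
      then show ?thesis using \<theta>[of m k] by simp
    qed
    show ?thesis using *[of m "n - m"] *[of n "m - n"] by (cases "m \<le> n") (auto simp: abs_minus_commute)
  qed
  have Uinj: "n = m" if "U n = U m + real_of_int z" for n m z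
  proof (rule ccontr)
    assume "n \<noteq> m"
    then have "\<theta> = real_of_int (factor_sum s 0 n - factor_sum s 0 m - z) / real_of_int (int n - int m)"
      using that by (simp add: U_def field_simps)
    then have "\<theta> \<in> \<rat>" by simp
    then show False using irr by simp
  qed
  define I where "I = Inf (range U)"
  have bdd: "bdd_below (range U)"
    using Ud[of _ 0] by (intro bdd_belowI[of _ "U 0 - 1"]) (auto simp: abs_le_iff algebra_simps)
  have I1: "I \<le> U n" for n unfolding I_def by (intro cInf_lower bdd) auto
  have I2: "U n \<le> I + 1" for n
  proof -
    have "U n - 1 \<le> I" unfolding I_def
      using Ud[of n] by (intro cInf_greatest) (auto simp: abs_le_iff algebra_simps)
    then show ?thesis by simp
  qed
  have sF: "s n = factor_sum s 0 (n + 1) - factor_sum s 0 n" for n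
    by (simp add: factor_sum_Suc)
  have "(\<exists>\<rho>. \<forall>n. factor_sum s 0 n = \<lfloor>real (n + 1) * \<theta> + \<rho>\<rfloor>) \<or>
        (\<exists>\<rho>. \<forall>n. factor_sum s 0 n = \<lceil>real (n + 1) * \<theta> + \<rho>\<rceil>)"
  proof (cases "\<exists>m. U m = I + 1")
    case True
    then obtain m where m: "U m = I + 1" by blast
    have gt: "I < U n" for n
    proof -
      have "U n \<noteq> I" using Uinj[of m n 1] m by auto
      then show ?thesis using I1[of n] by simp
    qed
    \<comment> \<open>The offset is lowered by \<open>\<theta>\<close> because
      \<open>sturmian\<close> starts at \<open>real (n + 1) * \<theta>\<close>; in effect
      \<open>n * \<theta> + I + 1\<close> is rounded.\<close>
    have "\<lfloor>real (n + 1) * \<theta> + (I + 1 - \<theta>)\<rfloor> = factor_sum s 0 n" for n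
      unfolding floor_eq_iff using I2[of n] gt[of n] unfolding U_def by (simp add: algebra_simps)
    then have "\<forall>n. factor_sum s 0 n = \<lfloor>real (n + 1) * \<theta> + (I + 1 - \<theta>)\<rfloor>" by metis
    then show ?thesis by blast
  next
    case False
    then have lt: "U n < I + 1" for n using I2[of n] by (auto simp: less_le)
    have "\<lceil>real (n + 1) * \<theta> + (I - \<theta>)\<rceil> = factor_sum s 0 n" for n
      unfolding ceiling_eq_iff using I1[of n] lt[of n] unfolding U_def by (simp add: algebra_simps)
    then have "\<forall>n. factor_sum s 0 n = \<lceil>real (n + 1) * \<theta> + (I - \<theta>)\<rceil>" by metis
    then show ?thesis by blast
  qed
  then show ?thesis unfolding sturmian_def
    using assms(1) \<theta>01 irr sF by (metis (no_types, lifting) add.assoc one_add_one)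
qed

text \<open>A shortest pair of equally long factors whose sums differ by at least 2 has the form
  1u1, 0u0. Behind the first letters the tails share u and then have 1 against 0, so by
  \<open>le'\<close> the first tail is the larger one, against \<open>le\<close>.\<close>

lemma balancedI:
  assumes bin: "range s \<subseteq> {0, 1}"
    and x: "0 < x" "x < 1"
    and le: "\<And>i j. s i = 0 \<Longrightarrow> s j = 1 \<Longrightarrow>
      word_series x (suffix (Suc j) s) \<le> word_series x (suffix (Suc i) s)"
    and le': "\<And>i j. s i = 0 \<Longrightarrow> s j = 1 \<Longrightarrow>
      word_series x (suffix (Suc i) s) - word_series x (suffix (Suc j) s) < 1"
  shows "balanced s"
proof (rule ccontr)
  assume "\<not> balanced s"
  then have ex: "\<exists>k m n. factor_sum s m k - factor_sum s n k \<ge> 2"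
  proof -
    obtain m n k where "\<not> factor_sum s m k - factor_sum s n k \<le> 1"
      using \<open>\<not> balanced s\<close> unfolding balanced_def by blast
    then show ?thesis by (intro exI[of _ k] exI[of _ m] exI[of _ n]) linarith
  qed
  have s01: "s n = 0 \<or> s n = 1" for n using bin by auto
  define k where "k = (LEAST k. \<exists>m n. factor_sum s m k - factor_sum s n k \<ge> 2)"
  obtain m n where mn: "factor_sum s m k - factor_sum s n k \<ge> 2"
    unfolding k_def using LeastI_ex[OF ex] by blast
  have min: "factor_sum s m' i - factor_sum s n' i \<le> 1" if "i < k" for m' n' i
  proof -
    have "\<not> 2 \<le> factor_sum s m' i - factor_sum s n' i"
      using not_less_Least[OF that[unfolded k_def]] by blast
    then show ?thesis by linarith
  qed
  \<comment> \<open>By minimality neither a proper prefix nor the rest contributes more than 1 to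
    the difference, so the prefix contributes exactly 1.\<close>
  have one: "factor_sum s m i - factor_sum s n i = 1" if "0 < i" "i < k" for i
  proof -
    have "factor_sum s m (i + (k - i)) - factor_sum s n (i + (k - i)) \<ge> 2" using mn that by simp
    moreover have "factor_sum s (m + i) (k - i) - factor_sum s (n + i) (k - i) \<le> 1"
      using that by (intro min) simp
    ultimately show ?thesis using min[OF that(2), of m n] unfolding factor_sum_add by linarith
  qed
  have "k \<noteq> 0" using mn by (intro notI) simp
  moreover have "k \<noteq> 1" using mn s01[of m] s01[of n] by (auto simp: factor_sum_def)
  ultimately obtain h where h: "k = Suc (Suc h)" by (metis One_nat_def not0_implies_Suc)
  have "s m - s n = 1" using one[of 1] by (simp add: h factor_sum_def)
  then have first: "s m = 1" "s n = 0" using s01[of m] s01[of n] by auto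
  have "s (m + Suc h) - s (n + Suc h) \<ge> 1"
    using mn one[of "Suc h"] by (simp add: h factor_sum_Suc)
  then have last: "s (m + Suc h) = 1" "s (n + Suc h) = 0"
    using s01[of "m + Suc h"] s01[of "n + Suc h"] by auto
  have mid: "s (Suc m + i) = s (Suc n + i)" if "i < h" for i
    using one[of "Suc i"] one[of "Suc (Suc i)"] that by (simp add: h factor_sum_Suc)
  let ?X = "\<lambda>i. word_series x (suffix i s)"
  have fin: "finite (range s)" by (rule finite_range_binary[OF bin])
  have ax: "\<bar>x\<bar> < 1" using x by simp
  have "?X (Suc m) - ?X (Suc n) = x ^ h * (?X (Suc m + h) - ?X (Suc n + h))"
    by (rule word_series_diff[OF fin fin ax mid])
  moreover have "?X (Suc m + h) - ?X (Suc n + h) = x * (1 - (?X (Suc (n + Suc h)) - ?X (Suc (m + Suc h))))"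
    using word_series_suffix[OF fin ax, of "m + Suc h"] word_series_suffix[OF fin ax, of "n + Suc h"] last
    by (simp add: right_diff_distrib distrib_left)
  ultimately have eq: "?X (Suc m) - ?X (Suc n) =
      x ^ h * (x * (1 - (?X (Suc (n + Suc h)) - ?X (Suc (m + Suc h)))))"
    by (simp only:)
  have "0 < x ^ h * (x * (1 - (?X (Suc (n + Suc h)) - ?X (Suc (m + Suc h)))))"
    using le'[OF last(2,1)] x by (intro mult_pos_pos zero_less_power) simp_all
  then show False using le[OF first(2,1)] eq by linarith
qed

section \<open>Words of small spread\<close>

lemma aperiodic_absorbing_letter:
  assumes "aperiodic v" "v i = a" "\<And>n. v n = a \<Longrightarrow> v (Suc n) = a"
  shows False
proof -
  have "v (i + k) = a" for k using assms(2,3) by (induction k) simp_all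
  then have "v n = a" if "n \<ge> i" for n using that by (metis le_add_diff_inverse)
  then show False using aperiodic_not_eventually_const[OF assms(1), of i a] by blast
qed

text \<open>Letters at distance at least 2 have distance exactly 2, and the letter after the larger
  one then exceeds the letter after the smaller one. As the least letter \<open>p\<close> is
  somewhere followed by a different one, a letter \<open>p + 2\<close> could only be followed by
  \<open>p + 2\<close>, against aperiodicity.\<close>

lemma two_consecutive_letters:
  fixes v :: "int word"
  assumes fin: "finite (range v)" and ap: "aperiodic v" and r: "0 < r" "r < 1"
    and spread: "\<And>m n. word_series (- r) (suffix m v) - word_series (- r) (suffix n v) \<le> r + r\<^sup>2 - r ^ 3"
  obtains p where "\<And>n. v n = p \<or> v n = p + 1"
proof -
  define t where "t n = word_series (- r) (suffix n v)" for n
  have t_rec: "t n = - r * (real_of_int (v n) + t (Suc n))" for n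
    unfolding t_def using r by (intro word_series_suffix fin) simp
  have "0 < (1 - r) * (1 - r\<^sup>2)" using r by (intro mult_pos_pos) (simp_all add: power_less_one_iff abs_square_less_1)
  also have "\<dots> = 1 - (r + r\<^sup>2 - r ^ 3)" by (simp add: algebra_simps power2_eq_square power3_eq_cube)
  finally have L: "r + r\<^sup>2 - r ^ 3 < 1" by simp
  have step: "v j - v i = 2" "1 \<le> v (Suc j) - v (Suc i)" if "2 \<le> v j - v i" for i j
  proof -
    let ?d = "real_of_int (v j - v i)" and ?e = "real_of_int (v (Suc j) - v (Suc i))"
    have "t i - t j = r * (?d - (t (Suc i) - t (Suc j)))"
      using t_rec[of i] t_rec[of j] by (simp add: algebra_simps)
    then have "r * (?d - (t (Suc i) - t (Suc j))) \<le> r * (1 + r - r\<^sup>2)"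
      using spread[of i j] by (simp add: t_def algebra_simps power2_eq_square power3_eq_cube)
    then have d: "?d - (1 + r - r\<^sup>2) \<le> t (Suc i) - t (Suc j)"
      using r by (simp only: mult_le_cancel_left_pos)
    moreover have "r < 1 + r\<^sup>2" using r zero_less_power[OF r(1), of 2] by linarith
    moreover have "t (Suc i) - t (Suc j) < 1" using spread[of "Suc i" "Suc j"] L by (simp add: t_def)
    ultimately have "?d < 3" by linarith
    then show "v j - v i = 2" using that by linarith
    then have d': "1 - r + r\<^sup>2 \<le> t (Suc i) - t (Suc j)" using d by simp
    have eq: "t (Suc i) - t (Suc j) = r * (?e + (t (Suc (Suc j)) - t (Suc (Suc i))))"
      using t_rec[of "Suc i"] t_rec[of "Suc j"] by (simp add: algebra_simps)
    show "1 \<le> v (Suc j) - v (Suc i)"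
    proof (rule ccontr)
      assume "\<not> ?thesis"
      then have "?e \<le> 0" by simp
      then have "?e + (t (Suc (Suc j)) - t (Suc (Suc i))) \<le> r + r\<^sup>2 - r ^ 3"
        using spread[of "Suc (Suc j)" "Suc (Suc i)"] unfolding t_def by linarith
      then have "t (Suc i) - t (Suc j) \<le> r * (r + r\<^sup>2 - r ^ 3)"
        unfolding eq using r by (intro mult_left_mono) simp_all
      \<comment> \<open>The lower bound \<open>1 - r + r\<^sup>2\<close> and the upper bound
        \<open>r\<^sup>2 + r ^ 3 - r ^ 4\<close> share \<open>r\<^sup>2\<close>; what remains has
        the factor \<open>1 - r\<close>.\<close>
      then have "(1 - r) * 1 \<le> (1 - r) * r ^ 3"
        using d' by (simp add: algebra_simps eval_nat_numeral)
      then have "1 \<le> r ^ 3" using r by simp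
      then show False using power_Suc_less_one[OF r, of 2] by (simp add: eval_nat_numeral)
    qed
  qed
  define p where "p = Min (range v)"
  have p: "p \<le> v n" for n unfolding p_def using fin by (intro Min_le) auto
  have "p \<in> range v" unfolding p_def using fin by (intro Min_in) auto
  then obtain i0 where i0: "v i0 = p" by blast
  have "v j \<le> p + 1" for j
  proof (rule ccontr)
    assume "\<not> ?thesis"
    then have "2 \<le> v j - v i0" using i0 by simp
    then have j: "v j = p + 2" using step(1)[of j i0] i0 by simp
    obtain i where i: "v i = p" "v (Suc i) \<noteq> p"
      using aperiodic_absorbing_letter[OF ap i0] by blast
    have "v (Suc n) = p + 2" if "v n = p + 2" for n
    proof -
      have "v (Suc i) + 1 \<le> v (Suc n)" using step(2)[of n i] i that by simp
      moreover have "p < v (Suc i)" using p[of "Suc i"] i by simp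
      moreover have "v (Suc n) \<le> p + 2"
      proof (rule ccontr)
        assume "\<not> ?thesis"
        then show False using step(1)[of "Suc n" i0] i0 by simp
      qed
      ultimately show ?thesis by simp
    qed
    then show False using aperiodic_absorbing_letter[OF ap j] by blast
  qed
  then have "v n = p \<or> v n = p + 1" for n using p[of n] by (metis add1_zle_eq order_le_less antisym)
  then show ?thesis by (rule that)
qed

text \<open>The situation after subtracting the smaller letter. As a locale it can be interpreted
  for the word with 0 and 1 exchanged, which carries statements on runs of ones over to runs of
  zeros.\<close>

locale narrow_word =
  fixes w :: "int word" and r :: real
  assumes binary: "range w \<subseteq> {0, 1}" and aperiodic: "aperiodic w"
    and r0: "0 < r" and r1: "r < 1"
    and spread: "word_series (- r) (suffix m w) - word_series (- r) (suffix n w) \<le> r + r\<^sup>2 - r ^ 3"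
begin

abbreviation t :: "nat \<Rightarrow> real" where "t n \<equiv> word_series (- r) (suffix n w)"

lemma letter: "w n = 0 \<or> w n = 1"
  using binary by auto

lemma fin: "finite (range w)"
  by (rule finite_range_binary[OF binary])

lemma t_rec: "t n = - r * (real_of_int (w n) + t (Suc n))"
  using r0 r1 by (intro word_series_suffix fin) simp

lemma spread_less_1: "t m - t n < 1"
proof -
  have "0 < (1 - r) * (1 - r\<^sup>2)" using r0 r1 by (intro mult_pos_pos) (simp_all add: power_less_one_iff abs_square_less_1)
  also have "\<dots> = 1 - (r + r\<^sup>2 - r ^ 3)" by (simp add: algebra_simps power2_eq_square power3_eq_cube)
  finally show ?thesis using spread[of m n] by linarith
qed

text \<open>All values lie within distance less than \<open>1\<close> of each other, so the first differing letter
  decides the order.\<close>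

lemma alternating_order:
  assumes "\<And>i. i < k \<Longrightarrow> w (m + i) = w (n + i)" "w (m + k) = 0" "w (n + k) = 1"
  shows "even k \<Longrightarrow> t n < t m" "odd k \<Longrightarrow> t m < t n"
proof -
  have "t m - t n = (- r) ^ k * (t (m + k) - t (n + k))"
    using r0 r1 by (intro word_series_diff fin assms(1)) simp_all
  moreover have "t (m + k) - t (n + k) = r * (1 - (t (Suc (m + k)) - t (Suc (n + k))))"
    using t_rec[of "m + k"] t_rec[of "n + k"] assms(2,3) by (simp add: algebra_simps)
  ultimately have eq: "t m - t n = (- r) ^ k * (r * (1 - (t (Suc (m + k)) - t (Suc (n + k)))))"
    by (simp only:)
  have pos: "0 < r * (1 - (t (Suc (m + k)) - t (Suc (n + k))))"
    using r0 spread_less_1[of "Suc (m + k)" "Suc (n + k)"] by (intro mult_pos_pos) simp_all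
  show "t n < t m" if "even k"
  proof -
    have "0 < (- r) ^ k" using r0 that by (simp add: power_minus_even)
    then show ?thesis using eq mult_pos_pos[OF _ pos] by fastforce
  qed
  show "t m < t n" if "odd k"
  proof -
    have "(- r) ^ k < 0" using r0 that by (simp add: power_minus_odd)
    then show ?thesis using eq mult_neg_pos[OF _ pos] by fastforce
  qed
qed

text \<open>The values of 011x and 100y, with \<open>x\<close> and \<open>y\<close> denoting also
  the values of the tails, differ by \<open>r + r\<^sup>2 - r ^ 3 - r ^ 3 * (x - y)\<close>, so the
  bound on the spread says exactly \<open>y \<le> x\<close>. Other third letters would break the
  bound, since values of tails differ by less than 1.\<close>

lemma change_pair:
  assumes "w m = 0" "w (m + 1) = 1" "w n = 1" "w (n + 1) = 0"
  shows "w (m + 2) = 1" "w (n + 2) = 0" "t (n + 3) \<le> t (m + 3)"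
proof -
  have "t m = r\<^sup>2 + r\<^sup>2 * t (m + 2)"
  proof -
    have "t m = - r * t (m + 1)" "t (m + 1) = - r * (1 + t (m + 2))"
      using t_rec[of m] t_rec[of "m + 1"] assms by simp_all
    then have "t m = - r * (- r * (1 + t (m + 2)))" by (simp only:)
    then show ?thesis by (simp add: algebra_simps power2_eq_square)
  qed
  moreover have "t n = - r + r\<^sup>2 * t (n + 2)"
  proof -
    have "t n = - r * (1 + t (n + 1))" "t (n + 1) = - r * t (n + 2)"
      using t_rec[of n] t_rec[of "n + 1"] assms by simp_all
    then have "t n = - r * (1 + - r * t (n + 2))" by (simp only:)
    then show ?thesis by (simp add: algebra_simps power2_eq_square)
  qed
  ultimately have "r\<^sup>2 * (t (m + 2) - t (n + 2)) \<le> r\<^sup>2 * (- r)"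
    using spread[of m n] by (simp add: algebra_simps power2_eq_square power3_eq_cube)
  then have "t (m + 2) - t (n + 2) \<le> - r"
    using r0 by (simp only: mult_le_cancel_left_pos zero_less_power)
  moreover have "t (m + 2) - t (n + 2) =
      r * (real_of_int (w (n + 2)) - real_of_int (w (m + 2)) + (t (n + 3) - t (m + 3)))"
    using t_rec[of "m + 2"] t_rec[of "n + 2"] by (simp add: algebra_simps eval_nat_numeral)
  ultimately have "r * (real_of_int (w (n + 2)) - real_of_int (w (m + 2)) + (t (n + 3) - t (m + 3))) \<le> r * (- 1)"
    by simp
  then have *: "real_of_int (w (n + 2)) - real_of_int (w (m + 2)) + (t (n + 3) - t (m + 3)) \<le> - 1"
    using r0 by (simp only: mult_le_cancel_left_pos)
  then have "real_of_int (w (n + 2)) < real_of_int (w (m + 2))"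
    using spread_less_1[of "m + 3" "n + 3"] by linarith
  then show "w (m + 2) = 1" "w (n + 2) = 0"
    using letter[of "m + 2"] letter[of "n + 2"] by auto
  then show "t (n + 3) \<le> t (m + 3)" using * by simp
qed

text \<open>A run of ones of odd length forces the run of ones after the next two zeros to be odd and
  shorter, which gives an infinite descent.\<close>

lemma no_odd_run_of_ones:
  assumes "odd k"
  shows "\<not> (w n = 0 \<and> (\<forall>i<k. w (n + 1 + i) = 1) \<and> w (n + 1 + k) = 0)"
  using assms
proof (induction k arbitrary: n rule: less_induct)
  case (less k)
  show ?case
  proof
    assume A: "w n = 0 \<and> (\<forall>i<k. w (n + 1 + i) = 1) \<and> w (n + 1 + k) = 0"
    have "0 < k" using less.prems by (simp add: odd_pos)
    have c: "w (n + 2) = 1" "w (n + k + 2) = 0" "t (n + k + 3) \<le> t (n + 3)"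
    proof -
      have "w (n + k) = 1" using A[THEN conjunct2, THEN conjunct1, rule_format, of "k - 1"] \<open>0 < k\<close> by simp
      moreover have "w (n + 1) = 1" using A \<open>0 < k\<close> by (metis add_0_right)
      moreover have "w (n + k + 1) = 0" using A by (simp add: add_ac)
      ultimately show "w (n + 2) = 1" "w (n + k + 2) = 0" "t (n + k + 3) \<le> t (n + 3)"
        using change_pair[of n "n + k"] A by simp_all
    qed
    have "k \<noteq> 1" using c(1) A by (intro notI) simp
    then obtain h where h: "k = h + 2" "odd h"
      using less.prems \<open>0 < k\<close> by (metis One_nat_def Suc_1 Suc_lessI add.commute le_add_diff_inverse odd_add even_numeral less_eq_Suc_le)
    have x: "w (n + 3 + i) = 1" if "i < h" for i
      using A[THEN conjunct2, THEN conjunct1, rule_format, of "i + 2"] that h by (simp add: eval_nat_numeral)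
    have x': "w (n + 3 + h) = 0" using A h by (simp add: eval_nat_numeral)
    have ex: "\<exists>i. w (n + k + 3 + i) \<noteq> 1"
      using aperiodic_not_eventually_const[OF aperiodic, of "n + k + 3" 1] by (metis le_add_diff_inverse)
    \<comment> \<open>\<open>j\<close> is the length of the run of ones from
      \<open>n + k + 3\<close> on, behind the zeros at \<open>n + k + 1\<close> and
      \<open>n + k + 2\<close>. Of the first run, \<open>h = k - 2\<close> ones remain from
      \<open>n + 3\<close> on.\<close>
    define j where "j = (LEAST i. w (n + k + 3 + i) \<noteq> 1)"
    have j: "w (n + k + 3 + j) = 0" unfolding j_def using LeastI_ex[OF ex] letter by blast
    have j': "w (n + k + 3 + i) = 1" if "i < j" for i
      using not_less_Least[of i "\<lambda>i. w (n + k + 3 + i) \<noteq> 1"] that unfolding j_def by auto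
    \<comment> \<open>The tail at \<open>n + 3\<close> has at least the value of the tail at
      \<open>n + k + 3\<close>. A first difference at the odd index \<open>h\<close> (if
      \<open>h < j\<close>) or at an even \<open>j < h\<close> would give the opposite
      order.\<close>
    have "j \<le> h"
    proof (rule ccontr)
      assume "\<not> j \<le> h"
      have "t (n + 3) < t (n + k + 3)"
      proof (rule alternating_order(2)[OF _ x' _ h(2)])
        show "w (n + k + 3 + h) = 1" using \<open>\<not> j \<le> h\<close> by (intro j') simp
        show "w (n + 3 + i) = w (n + k + 3 + i)" if "i < h" for i
          using x[OF that] j'[of i] that \<open>\<not> j \<le> h\<close> by simp
      qed
      then show False using c by simp
    qed
    moreover have "odd j"
    proof (cases "j = h")
      case False
      then have "j < h" using \<open>j \<le> h\<close> by simp
      show ?thesis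
      proof
        assume "even j"
        have "t (n + 3) < t (n + k + 3)"
        proof (rule alternating_order(1)[OF _ j x[OF \<open>j < h\<close>] \<open>even j\<close>])
          show "w (n + k + 3 + i) = w (n + 3 + i)" if "i < j" for i
            using x[of i] j'[OF that] that \<open>j < h\<close> by simp
        qed
        then show False using c by simp
      qed
    qed (use h in simp)
    ultimately have "j \<le> h" "odd j" by blast+
    show False
    proof -
      have e: "n + k + 2 + 1 = n + k + 3" by simp
      have "\<forall>i<j. w (n + k + 2 + 1 + i) = 1" unfolding e using j' by blast
      moreover have "w (n + k + 2 + 1 + j) = 0" unfolding e by (rule j)
      moreover have "j < k" using \<open>j \<le> h\<close> h(1) by simp
      ultimately show ?thesis using less.IH[OF _ \<open>odd j\<close>, of "n + k + 2"] c(2) by blast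
    qed
  qed
qed

text \<open>The values of the complementary word are \<open>- r / (1 + r)\<close> minus the given
  ones, so differences only change sign.\<close>

lemma complement: "narrow_word (\<lambda>n. 1 - w n) r"
proof
  show "range (\<lambda>n. 1 - w n) \<subseteq> {0, 1}" using letter by force
  show "Defs.aperiodic (\<lambda>n. 1 - w n)" using aperiodic unfolding aperiodic_def by simp
  show "0 < r" "r < 1" by (fact r0 r1)+
  have *: "word_series (- r) (suffix n (\<lambda>n. 1 - w n)) = - r / (1 + r) - t n" for n
  proof -
    have "suffix n (\<lambda>n. 1 - w n) = (\<lambda>i. 1 + - suffix n w i)" by (simp add: fun_eq_iff)
    moreover have "finite (range (\<lambda>i. - suffix n w i))"
      using finite_imageI[OF finite_range_suffix[OF fin, of n], of uminus] by (simp add: image_image)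
    then have "word_series (- r) (\<lambda>i. 1 + - suffix n w i) =
        real_of_int 1 * (- r) / (1 - (- r)) + word_series (- r) (\<lambda>i. - suffix n w i)"
      using r0 r1 by (intro word_series_add_const) simp_all
    moreover have "word_series (- r) (\<lambda>i. - suffix n w i) = - t n"
      using r0 r1 by (intro word_series_uminus finite_range_suffix[OF fin]) simp
    ultimately show ?thesis by simp
  qed
  show "word_series (- r) (suffix m (\<lambda>n. 1 - w n)) - word_series (- r) (suffix n (\<lambda>n. 1 - w n))
     \<le> r + r\<^sup>2 - r ^ 3" for m n
    unfolding * using spread[of n m] by simp
qed

section \<open>Runs of even length\<close>

lemma no_odd_run:
  assumes "odd k" "w n \<noteq> a" "\<And>i. i < k \<Longrightarrow> w (n + 1 + i) = a"
  shows "w (n + 1 + k) = a"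
proof -
  interpret c: narrow_word "\<lambda>n. 1 - w n" r by (rule complement)
  have "0 < k" using assms(1) by (simp add: odd_pos)
  then have "a = 0 \<or> a = 1" using assms(3)[of 0] letter by metis
  then show ?thesis
    using no_odd_run_of_ones[OF assms(1), of n] c.no_odd_run_of_ones[OF assms(1), of n] assms(2,3)
      letter[of n] letter[of "n + 1 + k"] by auto
qed

text \<open>If a pair at even distance from the change at \<open>l\<close> is broken, let
  \<open>q\<close> be the last earlier position whose letter differs from the first of the pair. The
  run from \<open>q + 1\<close> to this first letter cannot have odd length; if the length is even,
  \<open>q\<close> starts an earlier pair and would equal its successor.\<close>

lemma even_runs:
  assumes "0 < l" "w (l - 1) \<noteq> w l"
  shows "w (l + 2 * j) = w (l + 2 * j + 1)"
proof (induction j rule: less_induct)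
  case (less j)
  let ?a = "w (l + 2 * j)"
  show ?case
  proof (rule ccontr)
    assume neq: "w (l + 2 * j) \<noteq> w (l + 2 * j + 1)"
    define Q where "Q = {q. q < l + 2 * j \<and> w q \<noteq> ?a}"
    have fin: "finite Q" unfolding Q_def by simp
    have start: "\<exists>q\<in>Q. l - 1 \<le> q"
    proof (cases "w l = ?a")
      case True
      then show ?thesis using assms by (intro bexI[of _ "l - 1"]) (auto simp: Q_def)
    next
      case False
      then have "j \<noteq> 0" by (intro notI) simp
      then show ?thesis using False by (intro bexI[of _ l]) (auto simp: Q_def)
    qed
    define q where "q = Max Q"
    have q: "q \<in> Q" unfolding q_def using fin start by (intro Max_in) auto
    have "l - 1 \<le> q" using start Max_ge[OF fin] unfolding q_def by (meson order_trans)
    have run: "w i = ?a" if "q < i" "i \<le> l + 2 * j" for i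
    proof (rule ccontr)
      assume "w i \<noteq> ?a"
      then have "i \<in> Q" using that by (cases "i = l + 2 * j") (auto simp: Q_def)
      then show False using Max_ge[OF fin, of i] that(1) unfolding q_def by simp
    qed
    define k where "k = l + 2 * j - q"
    have k: "q + k = l + 2 * j" using q by (simp add: k_def Q_def)
    show False
    proof (cases "even k")
      case False
      have "w (q + 1 + k) = ?a"
      proof (rule no_odd_run[OF False])
        show "w q \<noteq> ?a" using q by (simp add: Q_def)
        show "w (q + 1 + i) = ?a" if "i < k" for i
          by (rule run) (use k that in simp_all)
      qed
      then show False using neq k by simp
    next
      case True
      then obtain i where i: "k = 2 * i" by blast
      have "q \<noteq> l - 1"
      proof
        assume "q = l - 1"
        then have "l = Suc q" using assms(1) by simp
        then have "odd k" using k by presburger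
        then show False using True by simp
      qed
      have "k > 0" using q by (simp add: k_def Q_def)
      have "l \<le> q" using \<open>l - 1 \<le> q\<close> \<open>q \<noteq> l - 1\<close> assms(1) by simp
      then have "q = l + 2 * (j - i)" "j - i < j" using k i \<open>k > 0\<close> by auto
      then have "w q = w (q + 1)" using less.IH[of "j - i"] by simp
      moreover have "w (q + 1) = ?a" using run[of "q + 1"] k \<open>k > 0\<close> by simp
      ultimately show False using q by (simp add: Q_def)
    qed
  qed
qed

text \<open>Behind the initial run the letters pair up and give a word \<open>s\<close>. Its balance
  is read off from its values \<open>X\<close> in base \<open>r\<^sup>2\<close>: a tail behind a 0
  is at least any tail behind a 1, and exceeds it by at most \<open>q\<close>.\<close>

theorem in_class_D: "w \<in> class_D"
proof -
  have ex: "\<exists>i. w i \<noteq> w 0" using aperiodic_not_eventually_const[OF aperiodic] by blast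
  define l where "l = (LEAST i. w i \<noteq> w 0)"
  have l: "w l \<noteq> w 0" unfolding l_def by (rule LeastI_ex[OF ex])
  have pre: "w i = w 0" if "i < l" for i
    using not_less_Least[of i "\<lambda>i. w i \<noteq> w 0"] that unfolding l_def by auto
  have "0 < l" using l by (cases l) auto
  have chg: "w (l - 1) \<noteq> w l" using pre[of "l - 1"] l \<open>0 < l\<close> by simp
  define s where "s j = w (l + 2 * j)" for j
  have suf: "suffix l w = doubling s"
  proof
    fix n
    show "suffix l w n = doubling s n"
    proof (cases "even n")
      case True
      then show ?thesis by (auto simp: s_def doubling_def elim: evenE)
    next
      case False
      then obtain m where "n = 2 * m + 1" by (elim oddE)
      then show ?thesis using even_runs[OF \<open>0 < l\<close> chg, of m] by (simp add: s_def doubling_def)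
    qed
  qed
  have w: "w = replicate l (w 0) \<frown> doubling s"
  proof
    fix n
    show "w n = (replicate l (w 0) \<frown> doubling s) n"
    proof (cases "n < l")
      case True
      then show ?thesis using pre[OF True] by (simp add: conc_def)
    next
      case False
      then show ?thesis by (simp add: conc_def suf[symmetric])
    qed
  qed
  have s01: "s n = 0 \<or> s n = 1" for n by (simp add: s_def letter)
  then have bin: "range s \<subseteq> {0, 1}" by auto
  note sfin = finite_range_binary[OF bin]
  define q where "q = r\<^sup>2"
  have q: "0 < q" "q < 1" "\<bar>q\<bar> < 1" using r0 r1 by (simp_all add: q_def power_less_one_iff abs_square_less_1)
  define X where "X j = word_series q (suffix j s)" for j
  have Xrec: "X j = q * (real_of_int (s j) + X (Suc j))" for j
    unfolding X_def by (rule word_series_suffix[OF sfin q(3)])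
  have X0: "0 \<le> X j" and X1: "X j \<le> q / (1 - q)" for j
    unfolding X_def using q bin by (intro word_series_binary_bounds; auto)+
  have tX: "t (l + 2 * j) = - ((1 - r) / r) * X j" for j
  proof -
    have "suffix (l + 2 * j) w = doubling (suffix j s)"
      using suf suffix_doubling[of j s] by (metis suffix_suffix)
    then show ?thesis
      using word_series_doubling[OF finite_range_suffix[OF sfin] r0 r1, of j] by (simp add: X_def q_def)
  qed
  have tX_le: "X i \<le> X j" if "t (l + 2 * j) \<le> t (l + 2 * i)" for i j
  proof -
    have "(1 - r) / r * X i \<le> (1 - r) / r * X j" using that by (simp add: tX)
    then show ?thesis using r0 r1 by (simp only: mult_le_cancel_left_pos divide_pos_pos diff_gt_0_iff_gt)
  qed
  have prev: "w (l + 2 * Suc j - 1) = s j" for j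
    using even_runs[OF \<open>0 < l\<close> chg, of j] by (simp add: s_def)
  have pair: "w (l + 2 * j + 1) = s j" for j
    using even_runs[OF \<open>0 < l\<close> chg, of j] by (simp add: s_def)
  \<comment> \<open>A 0 of \<open>s\<close> preceded in \<open>w\<close> by 1 is a change 10, a 1
    preceded by 0 a change 01. At index 0 the preceding letter is the last one of the initial
    run.\<close>
  have base: "X (Suc j) \<le> X (Suc i)"
    if "s i = 0" "w (l + 2 * i - 1) = 1" "s j = 1" "w (l + 2 * j - 1) = 0" for i j
  proof -
    have "t (l + 2 * i - 1 + 3) \<le> t (l + 2 * j - 1 + 3)"
      using that \<open>0 < l\<close> by (intro change_pair) (auto simp: s_def)
    then show ?thesis using \<open>0 < l\<close> by (intro tX_le) simp
  qed
  \<comment> \<open>The condition on the letter before \<open>j\<close> is removed by going through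
    the run of ones, along which tails do not increase because of \<open>X1\<close>.\<close>
  have up: "X (Suc j) \<le> X (Suc i)"
    if "s i = 0" "w (l + 2 * i - 1) = 1" "s j = 1" for i j
    using that(3)
  proof (induction j)
    case 0
    have "w (l + 2 * 0 - 1) = 0" using chg 0 letter[of "l - 1"] by (simp add: s_def)
    then show ?case by (intro base that 0)
  next
    case (Suc j)
    show ?case
    proof (cases "s j = 0")
      case True
      then show ?thesis using prev[of j] by (intro base that Suc) simp
    next
      case False
      then have "s j = 1" using s01 by blast
      then have "X (Suc j) \<le> X (Suc i)" by (rule Suc.IH)
      moreover have "X (Suc (Suc j)) \<le> X (Suc j)"
        using Xrec[of "Suc j"] Suc.prems X1[of "Suc (Suc j)"] q by (simp add: field_simps)
      ultimately show ?thesis by simp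
    qed
  qed
  \<comment> \<open>Likewise for \<open>i\<close> along a run of zeros: passing a 0 divides the tail
    by \<open>q\<close>, so tails do not decrease.\<close>
  have order: "X (Suc j) \<le> X (Suc i)" if "s i = 0" "s j = 1" for i j
    using that(1)
  proof (induction i)
    case 0
    have "w (l + 2 * 0 - 1) = 1" using chg 0 letter[of "l - 1"] by (simp add: s_def)
    then show ?case by (intro up that 0)
  next
    case (Suc i)
    show ?case
    proof (cases "s i = 0")
      case True
      then have "X (Suc j) \<le> X (Suc i)" by (rule Suc.IH)
      also have "X (Suc i) \<le> X (Suc (Suc i))"
        using Xrec[of "Suc i"] Suc.prems X0[of "Suc (Suc i)"] q by (simp add: mult_left_le_one_le)
      finally show ?thesis .
    next
      case False
      then have "s i = 1" using s01 by blast
      then show ?thesis using prev[of i] by (intro up that Suc) simp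
    qed
  qed
  \<comment> \<open>At the second letters of the two pairs the values differ by
    \<open>r + (1 - r) * (X (Suc i) - X (Suc j))\<close>, and the bound on the spread is
    \<open>r + (1 - r) * q\<close>.\<close>
  have gap: "X (Suc i) - X (Suc j) \<le> q" if "s i = 0" "s j = 1" for i j
  proof -
    have "t (l + 2 * i + 1) = (1 - r) * X (Suc i)"
      using t_rec[of "l + 2 * i + 1"] tX[of "Suc i"] pair[of i] that r0 by simp
    moreover have "t (l + 2 * j + 1) = - r + (1 - r) * X (Suc j)"
      using t_rec[of "l + 2 * j + 1"] tX[of "Suc j"] pair[of j] that r0 by (simp add: field_simps)
    ultimately have "(1 - r) * (X (Suc i) - X (Suc j)) \<le> (1 - r) * q"
      using spread[of "l + 2 * i + 1" "l + 2 * j + 1"]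
      by (simp add: algebra_simps q_def power2_eq_square power3_eq_cube)
    then show ?thesis using r1 by simp
  qed
  have "balanced s"
  proof (rule balancedI[OF bin q(1,2)])
    fix i j assume ij: "s i = 0" "s j = 1"
    show "word_series q (suffix (Suc j) s) \<le> word_series q (suffix (Suc i) s)"
      using order[OF ij] by (simp only: X_def)
    show "word_series q (suffix (Suc i) s) - word_series q (suffix (Suc j) s) < 1"
      using gap[OF ij] q(2) by (simp only: X_def)
  qed
  moreover have "Defs.aperiodic s"
    using aperiodic_doublingD aperiodic_suffix[OF aperiodic, of l] suf by metis
  ultimately have "sturmian s" using bin by (intro balanced_aperiodic_imp_sturmian)
  moreover have "w = replicate l 0 \<frown> doubling s \<or> w = replicate l 1 \<frown> doubling s"
    using w letter[of 0] by metis
  ultimately show ?thesis unfolding class_D_def by blast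
qed

end

section \<open>Words with confined factor sums\<close>

lemma char_word_conv: "char_word \<theta> n = \<lfloor>real (Suc n) * \<theta> + \<theta>\<rfloor> - \<lfloor>real (Suc n) * \<theta>\<rfloor>"
  by (simp add: char_word_def algebra_simps)

lemma range_char_word:
  assumes "0 < \<theta>" "\<theta> < 1"
  shows "range (char_word \<theta>) \<subseteq> {0, 1}"
proof (rule image_subsetI)
  fix n
  have "\<lfloor>real (Suc n) * \<theta>\<rfloor> \<le> \<lfloor>real (Suc n) * \<theta> + \<theta>\<rfloor>"
    "\<lfloor>real (Suc n) * \<theta> + \<theta>\<rfloor> \<le> \<lfloor>real (Suc n) * \<theta>\<rfloor> + 1"
    using assms by linarith+
  then show "char_word \<theta> n \<in> {0, 1}" unfolding char_word_conv by force
qed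

lemma factor_sum_char_word:
  assumes "0 < \<theta>" "\<theta> < 1"
  shows "factor_sum (char_word \<theta>) 0 k = \<lfloor>real (Suc k) * \<theta>\<rfloor>"
proof (induction k)
  case 0
  show ?case using assms by (simp add: floor_eq_iff)
next
  case (Suc k)
  then show ?case by (simp add: factor_sum_Suc char_word_def)
qed

lemma factor_sum_Cons: "factor_sum ([a] \<frown> c) 0 (Suc k) = a + factor_sum c 0 k"
  by (induction k) (simp_all add: factor_sum_Suc)

text \<open>The form in which Sturmian words enter the estimates: it treats floor words, ceiling
  words and complements alike and fixes the slope \<open>\<theta>\<close>.\<close>

locale confined_word =
  fixes s :: "int word" and \<theta> :: real
  assumes binary: "range s \<subseteq> {0, 1}"
    and \<theta>: "0 < \<theta>" "\<theta> < 1" and irrational: "\<theta> \<notin> \<rat>"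
    and lower: "\<lfloor>real k * \<theta>\<rfloor> \<le> factor_sum s n k"
    and upper: "factor_sum s n k \<le> \<lfloor>real k * \<theta>\<rfloor> + 1"

text \<open>Factor sums telescope to differences of floors or ceilings at points at distance
  \<open>k * \<theta>\<close>; either kind of difference is
  \<open>\<lfloor>k * \<theta>\<rfloor>\<close> or one more.\<close>

lemma sturmian_confined:
  assumes "sturmian s"
  obtains \<theta> where "confined_word s \<theta>"
proof -
  obtain \<theta> \<rho> where \<theta>: "0 < \<theta>" "\<theta> < 1" "\<theta> \<notin> \<rat>" and bin: "range s \<subseteq> {0, 1}" and
    s: "(\<forall>n. s n = \<lfloor>real (n + 2) * \<theta> + \<rho>\<rfloor> - \<lfloor>real (n + 1) * \<theta> + \<rho>\<rfloor>) \<or>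
        (\<forall>n. s n = \<lceil>real (n + 2) * \<theta> + \<rho>\<rceil> - \<lceil>real (n + 1) * \<theta> + \<rho>\<rceil>)"
    using assms unfolding sturmian_def by blast
  have "\<lfloor>real k * \<theta>\<rfloor> \<le> factor_sum s n k \<and> factor_sum s n k \<le> \<lfloor>real k * \<theta>\<rfloor> + 1" for n k
    using s
  proof
    assume s: "\<forall>n. s n = \<lfloor>real (n + 2) * \<theta> + \<rho>\<rfloor> - \<lfloor>real (n + 1) * \<theta> + \<rho>\<rfloor>"
    have "factor_sum s n k = \<lfloor>real (n + k + 1) * \<theta> + \<rho>\<rfloor> - \<lfloor>real (n + 1) * \<theta> + \<rho>\<rfloor>"
      by (induction k) (simp_all add: factor_sum_Suc s)
    moreover have "real (n + k + 1) * \<theta> + \<rho> = real k * \<theta> + (real (n + 1) * \<theta> + \<rho>)"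
      by (simp add: algebra_simps)
    ultimately show ?thesis by linarith
  next
    assume s: "\<forall>n. s n = \<lceil>real (n + 2) * \<theta> + \<rho>\<rceil> - \<lceil>real (n + 1) * \<theta> + \<rho>\<rceil>"
    have "factor_sum s n k = \<lceil>real (n + k + 1) * \<theta> + \<rho>\<rceil> - \<lceil>real (n + 1) * \<theta> + \<rho>\<rceil>"
      by (induction k) (simp_all add: factor_sum_Suc s)
    moreover have "real (n + k + 1) * \<theta> + \<rho> = real k * \<theta> + (real (n + 1) * \<theta> + \<rho>)"
      by (simp add: algebra_simps)
    ultimately show ?thesis by linarith
  qed
  then show ?thesis using \<theta> bin by (intro that confined_word.intro) auto
qed

lemma char_word_confined:
  assumes "0 < \<theta>" "\<theta> < 1" "\<theta> \<notin> \<rat>"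
  shows "confined_word (char_word \<theta>) \<theta>"
proof
  show "range (char_word \<theta>) \<subseteq> {0, 1}" using assms by (intro range_char_word)
  show "0 < \<theta>" "\<theta> < 1" "\<theta> \<notin> \<rat>" by (fact assms)+
  fix n k
  have "factor_sum (char_word \<theta>) n k = \<lfloor>real (Suc (n + k)) * \<theta>\<rfloor> - \<lfloor>real (Suc n) * \<theta>\<rfloor>"
    using factor_sum_add[of "char_word \<theta>" 0 n k] factor_sum_char_word[OF assms(1,2)] by simp
  moreover have "real (Suc (n + k)) * \<theta> = real k * \<theta> + real (Suc n) * \<theta>"
    by (simp add: algebra_simps)
  ultimately show "\<lfloor>real k * \<theta>\<rfloor> \<le> factor_sum (char_word \<theta>) n k"
    "factor_sum (char_word \<theta>) n k \<le> \<lfloor>real k * \<theta>\<rfloor> + 1"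
    by linarith+
qed

context confined_word
begin

abbreviation c :: "int word" where "c \<equiv> char_word \<theta>"

lemma letter: "s n = 0 \<or> s n = 1"
  using binary by auto

lemma sum_suffix: "(\<Sum>i<k. suffix n s i) = factor_sum s n k"
  by (simp add: factor_sum_def)

lemma binary_c: "range c \<subseteq> {0, 1}"
  by (rule range_char_word[OF \<theta>])

text \<open>With the next lemma: 0c and 1c attain the two bounds of \<open>confined_word\<close> at
  every positive length, which makes them extremal.\<close>

lemma factor_sum_0c: "factor_sum ([0] \<frown> c) 0 k = \<lfloor>real k * \<theta>\<rfloor>"
proof (cases k)
  case (Suc j)
  then show ?thesis by (simp only: factor_sum_Cons factor_sum_char_word[OF \<theta>])
qed simp

lemma factor_sum_1c: "0 < k \<Longrightarrow> factor_sum ([1] \<frown> c) 0 k = \<lfloor>real k * \<theta>\<rfloor> + 1"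
proof (cases k)
  case (Suc j)
  then show ?thesis by (simp only: factor_sum_Cons factor_sum_char_word[OF \<theta>])
qed simp

lemma frac_pos: "0 < k \<Longrightarrow> real_of_int \<lfloor>real k * \<theta>\<rfloor> < real k * \<theta>"
proof -
  assume "0 < k"
  have "real_of_int \<lfloor>real k * \<theta>\<rfloor> \<noteq> real k * \<theta>"
  proof
    assume e: "real_of_int \<lfloor>real k * \<theta>\<rfloor> = real k * \<theta>"
    have "\<theta> = real_of_int \<lfloor>real k * \<theta>\<rfloor> / real_of_int (int k)" unfolding e using \<open>0 < k\<close> by simp
    then have "\<theta> \<in> \<rat>" by (metis Rats_divide Rats_of_int)
    then show False using irrational by simp
  qed
  then show ?thesis using of_int_floor_le[of "real k * \<theta>"] by linarith
qed

text \<open>For \<open>k > 0\<close> irrationality gives \<open>\<lfloor>k * (1 - \<theta>)\<rfloor>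
  = k - \<lfloor>k * \<theta>\<rfloor> - 1\<close>, so the two bounds change roles.\<close>

lemma complement: "confined_word (\<lambda>n. 1 - s n) (1 - \<theta>)"
proof
  show "range (\<lambda>n. 1 - s n) \<subseteq> {0, 1}" using letter by force
  show "0 < 1 - \<theta>" "1 - \<theta> < 1" using \<theta> by simp_all
  show "1 - \<theta> \<notin> \<rat>"
  proof
    assume "1 - \<theta> \<in> \<rat>"
    from Rats_diff[OF Rats_1 this] show False using irrational by simp
  qed
  fix n k
  have "factor_sum (\<lambda>n. 1 - s n) n k = int k - factor_sum s n k"
    by (simp add: factor_sum_def sum_subtractf)
  moreover have "\<lfloor>real k * (1 - \<theta>)\<rfloor> = (if k = 0 then 0 else int k - \<lfloor>real k * \<theta>\<rfloor> - 1)"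
    using frac_pos[of k] by (auto simp: floor_eq_iff algebra_simps) linarith+
  ultimately show "\<lfloor>real k * (1 - \<theta>)\<rfloor> \<le> factor_sum (\<lambda>n. 1 - s n) n k"
    "factor_sum (\<lambda>n. 1 - s n) n k \<le> \<lfloor>real k * (1 - \<theta>)\<rfloor> + 1"
    using lower[of k n] upper[of n k] by auto
qed

lemma word_series_bounds:
  assumes q: "0 < q" "q < 1"
  defines "C \<equiv> word_series q c"
  shows "q * C \<le> word_series q (suffix n s)"
    and "word_series q (suffix n s) = q * C \<Longrightarrow> suffix n s = [0] \<frown> c"
    and "word_series q (suffix n s) \<le> q * (1 + C)"
    and "word_series q (suffix n s) = q * (1 + C) \<Longrightarrow> suffix n s = [1] \<frown> c"
proof -
  have bs: "range (suffix n s) \<subseteq> {0, 1}" using binary by auto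
  have b0: "range ([0] \<frown> c) \<subseteq> {0, 1}" and b1: "range ([1] \<frown> c) \<subseteq> {0, 1}" using binary_c by auto
  have *: "word_series q ([a] \<frown> c) = q * (real_of_int a + C)" for a
    using word_series_Cons[of "[a] \<frown> c" q] q finite_range_binary[OF binary_c]
    by (simp add: C_def suffix_def)
  have sum: "(\<Sum>i<k. u i) = factor_sum u 0 k" for u k by (simp add: factor_sum_def)
  have le0: "(\<Sum>i<k. ([0] \<frown> c) i) \<le> (\<Sum>i<k. suffix n s i)" for k
    unfolding sum_suffix unfolding sum factor_sum_0c by (rule lower)
  have le1: "(\<Sum>i<k. suffix n s i) \<le> (\<Sum>i<k. ([1] \<frown> c) i)" for k
    unfolding sum_suffix unfolding sum using upper[of n k] factor_sum_1c[of k] by (cases "k = 0") simp_all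
  have ge: "word_series q ([0] \<frown> c) \<le> word_series q (suffix n s)"
    by (rule word_series_mono(1)[OF b0 bs q le0])
  have le: "word_series q (suffix n s) \<le> word_series q ([1] \<frown> c)"
    by (rule word_series_mono(1)[OF bs b1 q le1])
  show "q * C \<le> word_series q (suffix n s)"
    using ge unfolding *[of 0] by simp
  show "word_series q (suffix n s) \<le> q * (1 + C)"
    using le unfolding *[of 1] by simp
  show "suffix n s = [0] \<frown> c" if "word_series q (suffix n s) = q * C"
  proof -
    have "word_series q ([0] \<frown> c) = word_series q (suffix n s)" unfolding *[of 0] that by simp
    then have "[0] \<frown> c = suffix n s" by (rule word_series_mono(2)[OF b0 bs q le0])
    then show ?thesis by (rule sym)
  qed
  show "suffix n s = [1] \<frown> c" if "word_series q (suffix n s) = q * (1 + C)"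
  proof -
    have "word_series q (suffix n s) = word_series q ([1] \<frown> c)" unfolding *[of 1] that by simp
    then show ?thesis by (rule word_series_mono(2)[OF bs b1 q le1])
  qed
qed

text \<open>Where the discrepancy is almost minimal, all later factor sums are as large as possible.\<close>

lemma ex_large_factor_sums:
  "\<exists>n\<ge>n0. \<forall>k\<in>{1..N}. factor_sum s n k = \<lfloor>real k * \<theta>\<rfloor> + 1"
proof -
  define U where "U n = real_of_int (factor_sum s 0 n) - real n * \<theta>" for n
  \<comment> \<open>A positive lower bound for the fractional parts of \<open>k * \<theta>\<close>
    with \<open>1 \<le> k \<le> N\<close>; inserting 1 keeps the set nonempty for
    \<open>N = 0\<close>. From a discrepancy within \<open>\<epsilon>\<close> of its infimum no drop
    by \<open>\<epsilon>\<close> is possible, which pushes the factor sums above the floors.\<close>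
  define \<epsilon> where "\<epsilon> = Min (insert 1 ((\<lambda>k. real k * \<theta> - real_of_int \<lfloor>real k * \<theta>\<rfloor>) ` {1..N}))"
  have "0 < \<epsilon>" unfolding \<epsilon>_def using frac_pos by (subst Min_gr_iff) auto
  have \<epsilon>: "\<epsilon> \<le> real k * \<theta> - real_of_int \<lfloor>real k * \<theta>\<rfloor>" if "k \<in> {1..N}" for k
    unfolding \<epsilon>_def using that by (intro Min_le) auto
  have bdd: "bdd_below (U ` {n0..})"
  proof (rule bdd_belowI2)
    show "- 1 \<le> U n" for n using lower[of n 0] unfolding U_def by linarith
  qed
  obtain u where u: "u \<in> U ` {n0..}" "u < Inf (U ` {n0..}) + \<epsilon>"
    using cInf_lessD[of "U ` {n0..}" "Inf (U ` {n0..}) + \<epsilon>"] \<open>0 < \<epsilon>\<close> by auto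
  then obtain n where n: "n \<ge> n0" "U n < Inf (U ` {n0..}) + \<epsilon>" by auto
  have "factor_sum s n k = \<lfloor>real k * \<theta>\<rfloor> + 1" if k: "k \<in> {1..N}" for k
  proof -
    have "Inf (U ` {n0..}) \<le> U (n + k)" using n(1) by (intro cInf_lower bdd) auto
    then have "U n < U (n + k) + \<epsilon>" using n(2) by simp
    then have "real k * \<theta> - \<epsilon> < real_of_int (factor_sum s n k)"
      using factor_sum_add[of s 0 n k] by (simp add: U_def algebra_simps)
    then have "\<lfloor>real k * \<theta>\<rfloor> < factor_sum s n k" using \<epsilon>[OF k] by linarith
    then show ?thesis using upper[of n k] by simp
  qed
  then show ?thesis using n(1) by blast
qed

text \<open>As \<open>\<theta> < 1\<close>, the floor of \<open>k * \<theta>\<close> fails to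
  increase at some step from \<open>k\<close> to \<open>k + 1\<close>. In front of a factor sum that
  is maximal at length \<open>k\<close>, a 1 would then break the upper bound at length
  \<open>k + 1\<close>.\<close>

lemma ex_zero_before_large_factor_sums:
  "\<exists>n. s n = 0 \<and> (\<forall>k\<in>{1..N}. factor_sum s (Suc n) k = \<lfloor>real k * \<theta>\<rfloor> + 1)"
proof -
  have "\<exists>k\<ge>1. \<lfloor>real (Suc k) * \<theta>\<rfloor> \<le> \<lfloor>real k * \<theta>\<rfloor>"
  proof (rule ccontr)
    assume "\<not> ?thesis"
    then have step: "\<lfloor>real k * \<theta>\<rfloor> + 1 \<le> \<lfloor>real (Suc k) * \<theta>\<rfloor>" if "k \<ge> 1" for k using that by force
    have ge: "int k \<le> \<lfloor>real (Suc k) * \<theta>\<rfloor>" for k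
    proof (induction k)
      case 0
      then show ?case using \<theta> by simp
    next
      case (Suc k)
      then show ?case using step[of "Suc k"] by simp
    qed
    obtain k :: nat where "1 < real k * (1 - \<theta>)" using ex_less_of_nat_mult[of "1 - \<theta>" 1] \<theta> by auto
    moreover have "real k \<le> real (Suc k) * \<theta>" using ge[of k] by linarith
    ultimately show False using \<theta> by (simp add: algebra_simps)
  qed
  then obtain k where k: "k \<ge> 1" "\<lfloor>real (Suc k) * \<theta>\<rfloor> \<le> \<lfloor>real k * \<theta>\<rfloor>" by blast
  \<comment> \<open>The lower limit 1 guarantees a letter in front of \<open>m\<close>.\<close>
  obtain m where m: "m \<ge> 1" "\<forall>j\<in>{1..max N k}. factor_sum s m j = \<lfloor>real j * \<theta>\<rfloor> + 1"
    using ex_large_factor_sums[of 1 "max N k"] by blast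
  define n where "n = m - 1"
  have n: "m = Suc n" using m(1) by (simp add: n_def)
  have "factor_sum s n (Suc k) = s n + \<lfloor>real k * \<theta>\<rfloor> + 1"
    using m(2) k(1) by (simp add: factor_sum_Suc_left n)
  then have "s n \<le> 0" using upper[of n "Suc k"] k(2) by linarith
  then have "s n = 0" using letter[of n] by auto
  then show ?thesis using m(2) n by (intro exI[of _ n]) auto
qed

section \<open>Occurrences of the extremal prefixes\<close>

lemma agree_of_factor_sums:
  assumes "\<And>k. k \<le> N \<Longrightarrow> factor_sum u n k = factor_sum u' 0 k" "i < N"
  shows "u (n + i) = u' i"
  using assms(1)[of i] assms(1)[of "Suc i"] assms(2) by (simp add: factor_sum_Suc)

lemma ex_prefix_01c: "\<exists>n. s n = 0 \<and> (\<forall>i<N. s (Suc n + i) = ([1] \<frown> c) i)"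
proof -
  obtain n where n: "s n = 0" "\<forall>k\<in>{1..N}. factor_sum s (Suc n) k = \<lfloor>real k * \<theta>\<rfloor> + 1"
    using ex_zero_before_large_factor_sums by blast
  have "factor_sum s (Suc n) k = factor_sum ([1] \<frown> c) 0 k" if "k \<le> N" for k
    using n(2) that factor_sum_1c[of k] by (cases "k = 0") simp_all
  then show ?thesis using n(1) agree_of_factor_sums by blast
qed

lemma ex_prefix_10c: "\<exists>n. s n = 1 \<and> (\<forall>i<N. s (Suc n + i) = ([0] \<frown> c) i)"
proof -
  interpret co: confined_word "\<lambda>n. 1 - s n" "1 - \<theta>" by (rule complement)
  obtain n where n: "s n = 1"
    "\<forall>k\<in>{1..N}. factor_sum (\<lambda>n. 1 - s n) (Suc n) k = \<lfloor>real k * (1 - \<theta>)\<rfloor> + 1"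
    using co.ex_zero_before_large_factor_sums[of N] by auto
  have "factor_sum s (Suc n) k = factor_sum ([0] \<frown> c) 0 k" if "k \<le> N" for k
  proof (cases "k = 0")
    case False
    have "factor_sum (\<lambda>n. 1 - s n) (Suc n) k = int k - factor_sum s (Suc n) k"
      by (simp add: factor_sum_def sum_subtractf)
    moreover have "\<lfloor>real k * (1 - \<theta>)\<rfloor> = int k - \<lfloor>real k * \<theta>\<rfloor> - 1"
      using frac_pos[of k] False by (auto simp: floor_eq_iff algebra_simps) linarith+
    ultimately have "factor_sum s (Suc n) k = \<lfloor>real k * \<theta>\<rfloor>" using n(2) that False by simp
    then show ?thesis by (simp only: factor_sum_0c)
  qed simp
  then show ?thesis using n(1) agree_of_factor_sums by blast
qed

text \<open>The discrepancy \<open>V\<close> changes by at most 1 per letter and after each complete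
  pair equals its value at the end of \<open>xs\<close> plus twice a discrepancy of
  \<open>s\<close>. So it is bounded and vanishes after division by \<open>n\<close>.\<close>

lemma slope_doubling:
  assumes "range (xs \<frown> doubling s) \<subseteq> {0, 1}"
  shows "slope (xs \<frown> doubling s) = \<theta>"
proof -
  define u where "u = xs \<frown> doubling s"
  define V where "V n = (\<Sum>i<n. real_of_int (u i)) - real n * \<theta>" for n
  have u01: "u n = 0 \<or> u n = 1" for n using subsetD[OF assms rangeI[of _ n]] by (simp add: u_def)
  have step: "\<bar>V (Suc n) - V n\<bar> \<le> 1" for n
    using u01[of n] \<theta> by (auto simp: V_def algebra_simps)
  have V: "\<bar>V n\<bar> \<le> real n" for n
  proof (induction n)
    case (Suc n)
    then show ?case using step[of n] by simp
  qed (simp add: V_def)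
  let ?l = "length xs"
  have dbl: "V (?l + 2 * m) = V ?l + 2 * (real_of_int (factor_sum s 0 m) - real m * \<theta>)" for m
  proof (induction m)
    case (Suc m)
    have "u (?l + 2 * m) = s m" "u (Suc (?l + 2 * m)) = s m"
      by (simp_all add: u_def conc_def doubling_def)
    then show ?case using Suc by (simp add: V_def factor_sum_Suc algebra_simps)
  qed simp
  have even: "\<bar>V (?l + 2 * m)\<bar> \<le> real ?l + 2" for m
  proof -
    define d where "d = real_of_int (factor_sum s 0 m) - real m * \<theta>"
    have "\<bar>d\<bar> \<le> 1" using lower[of m 0] upper[of 0 m] unfolding d_def by linarith
    then show ?thesis using dbl[of m, folded d_def] V[of ?l] by linarith
  qed
  have bound: "\<bar>V n\<bar> \<le> real ?l + 3" for n
  proof (cases "n \<le> ?l")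
    case True
    then show ?thesis using V[of n] by linarith
  next
    case False
    obtain m where "n = ?l + 2 * m \<or> n = Suc (?l + 2 * m)"
    proof (cases "even (n - ?l)")
      case True
      then obtain m where "n - ?l = 2 * m" by (elim evenE)
      then have "n = ?l + 2 * m" using False by linarith
      then show ?thesis using that by blast
    next
      case odd: False
      then obtain m where "n - ?l = 2 * m + 1" by (elim oddE)
      then have "n = Suc (?l + 2 * m)" using False by linarith
      then show ?thesis using that by blast
    qed
    then show ?thesis using even[of m] step[of "?l + 2 * m"] by auto
  qed
  have "(\<lambda>n. V n / real n) \<longlonglongrightarrow> 0"
  proof (rule Lim_null_comparison)
    show "\<forall>\<^sub>F n in sequentially. norm (V n / real n) \<le> (real ?l + 3) / real n"
      using bound by (intro always_eventually allI) (simp add: divide_right_mono)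
    show "(\<lambda>n. (real ?l + 3) / real n) \<longlonglongrightarrow> 0" by (rule lim_const_over_n)
  qed
  then have "(\<lambda>n. \<theta> + V n / real n) \<longlonglongrightarrow> \<theta> + 0" by (intro tendsto_intros)
  moreover have "\<forall>\<^sub>F n in sequentially. \<theta> + V n / real n = (\<Sum>i<n. real_of_int (u i)) / real n"
    using eventually_gt_at_top[of 0] by eventually_elim (simp add: V_def field_simps)
  ultimately have "(\<lambda>n. (\<Sum>i<n. real_of_int (u i)) / real n) \<longlonglongrightarrow> \<theta> + 0"
    by (simp only: tendsto_cong)
  then show ?thesis unfolding slope_def u_def by (intro limI) simp
qed

end

section \<open>Values of doubled words\<close>

lemma word_series_conc_Cons:
  assumes "finite (range u)" "\<bar>x\<bar> < 1"
  shows "word_series x ((a # xs) \<frown> u) = x * (real_of_int a + word_series x (xs \<frown> u))"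
proof -
  have "suffix 1 ((a # xs) \<frown> u) = xs \<frown> u" by (auto simp: fun_eq_iff conc_def)
  moreover have "finite (range ((a # xs) \<frown> u))" using assms(1) by (simp only: range_conc) simp
  moreover have "((a # xs) \<frown> u) 0 = a" by (simp add: conc_def)
  ultimately show ?thesis using word_series_Cons[of "(a # xs) \<frown> u" x] assms(2) by (simp only:)
qed

lemma doubling_Cons: "doubling ([a] \<frown> u) = [a, a] \<frown> doubling u"
proof
  fix n
  consider "n = 0" | "n = 1" | m where "n = Suc (Suc m)" by (metis One_nat_def not0_implies_Suc)
  then show "doubling ([a] \<frown> u) n = ([a, a] \<frown> doubling u) n"
    by cases (simp_all add: doubling_def)
qed

lemma aperiodic_suffix_inj:
  assumes "aperiodic w" "suffix i w = suffix j w"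
  shows "i = j"
proof -
  have less: False if "i < j" "suffix i w = suffix j w" for i j
  proof -
    have "w n = w (n + (j - i))" if "n \<ge> i" for n
      using fun_cong[OF \<open>suffix i w = suffix j w\<close>, of "n - i"] that \<open>i < j\<close> by (simp add: add.commute)
    moreover have "1 \<le> j - i" using \<open>i < j\<close> by simp
    ultimately show False using assms(1) unfolding aperiodic_def by blast
  qed
  show ?thesis using less[of i j] less[of j i] assms(2) by (metis linorder_neqE_nat)
qed

text \<open>An element of \<open>class_D\<close> with a chosen representation. Below,
  \<open>A\<close> and \<open>B\<close> are the endpoints for \<open>g = 0\<close>;
  \<open>slope_w\<close> later confirms that \<open>\<theta>\<close> is the slope of
  \<open>w\<close>.\<close>

locale doubled_word = confined_word s \<theta> for s \<theta> +
  fixes r :: real and l :: nat and a :: int and w :: "int word"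
  assumes r: "0 < r" "r < 1"
    and a: "a = 0 \<or> a = 1"
    and w: "w = replicate l a \<frown> doubling s"
begin

abbreviation "t n \<equiv> word_series (- r) (suffix n w)"
abbreviation "q \<equiv> r\<^sup>2"
abbreviation "X j \<equiv> word_series q (suffix j s)"
abbreviation "C \<equiv> word_series q c"
abbreviation "A \<equiv> word_series (- r) ([1, 0, 0] \<frown> doubling c)"
abbreviation "B \<equiv> word_series (- r) ([0, 1, 1] \<frown> doubling c)"

section \<open>The two endpoints\<close>

lemma q: "0 < q" "q < 1"
  using r by (simp_all add: abs_square_less_1)

lemma finites: "finite (range s)" "finite (range c)" "finite (range (doubling s))" "finite (range (doubling c))"
  "finite (range w)"
  using finite_range_binary[OF binary] finite_range_binary[OF binary_c]
  by (simp_all add: range_doubling w)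

lemma range_w: "range w \<subseteq> {0, 1}"
  using a binary unfolding w by (auto simp: range_doubling)

lemma A_eq: "A = - r + (1 - r) * (q * C)"
  using r finites word_series_doubling[OF finites(2) r]
  by (simp only: word_series_conc_Cons[OF finites(4)] abs_minus_cancel abs_of_pos conc_empty)
     (simp add: field_simps power2_eq_square)

lemma B_eq: "B = (1 - r) * (q * (1 + C))"
  using r finites word_series_doubling[OF finites(2) r]
  by (simp only: word_series_conc_Cons[OF finites(4)] abs_minus_cancel abs_of_pos conc_empty)
     (simp add: field_simps power2_eq_square)

lemma length_AB: "B - A = r + r\<^sup>2 - r ^ 3"
  unfolding A_eq B_eq by (simp add: algebra_simps power2_eq_square power3_eq_cube)

lemma C_bounds: "0 \<le> C" "C * (1 - q) \<le> q"
proof -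
  show "0 \<le> C" using q by (intro word_series_binary_bounds binary_c) simp_all
  have "C \<le> q / (1 - q)" using q by (intro word_series_binary_bounds binary_c) simp_all
  then show "C * (1 - q) \<le> q" using q by (simp add: pos_le_divide_eq)
qed

lemma B_pos: "0 < B"
  unfolding B_eq using r C_bounds(1) by (intro mult_pos_pos) simp_all

text \<open>\<open>- r / (1 + r)\<close> is the value of the constant word of ones, around which the
  values in an initial run of ones alternate.\<close>

lemma A_less: "A < - r / (1 + r)"
proof -
  have "(1 + r) * (A + r) = q * (C * (1 - q))" unfolding A_eq by (simp add: algebra_simps power2_eq_square)
  also have "\<dots> \<le> q * q" using C_bounds(2) q by (intro mult_left_mono) simp_all
  also have "\<dots> < 1 * q" using q by (intro mult_strict_right_mono)
  finally have "(1 + r) * A < - r" by (simp add: algebra_simps power2_eq_square)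
  then show ?thesis using r by (subst pos_less_divide_eq) (simp_all add: mult.commute)
qed

lemma A_neg: "A < 0"
proof -
  have "- r / (1 + r) \<le> 0" using r by simp
  then show ?thesis using A_less by linarith
qed

text \<open>These are the values of shifts that start with a complete pair; they miss both
  endpoints.\<close>

lemma even_value_bounds:
  assumes "q * C \<le> x" "x \<le> q * (1 + C)"
  shows "A < - ((1 - r) / r) * x" "- ((1 - r) / r) * x < B"
proof -
  have "0 \<le> q * C" using q C_bounds(1) by simp
  then have "0 \<le> (1 - r) / r * x" using assms(1) r by (intro mult_nonneg_nonneg) auto
  then show "- ((1 - r) / r) * x < B" using B_pos by simp
  have "(1 - r) / r * x \<le> (1 - r) / r * (q * (1 + C))"
    using assms(2) r by (intro mult_left_mono) simp_all
  also have "\<dots> = (1 - r) * r * (1 + C)" using r by (simp add: field_simps power2_eq_square)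
  \<comment> \<open>Expanded, this is \<open>r * (C * (1 - q)) < r\<^sup>2\<close>.\<close>
  also have "\<dots> < r - (1 - r) * (q * C)"
  proof -
    have "r * (C * (1 - q)) \<le> r * q" using C_bounds(2) r by (intro mult_left_mono) simp_all
    also have "r * q < r * r" using r by (simp add: power2_eq_square)
    finally show ?thesis by (simp add: algebra_simps power2_eq_square)
  qed
  finally show "A < - ((1 - r) / r) * x" unfolding A_eq by simp
qed

text \<open>These are the values of shifts that start inside a pair, with \<open>b\<close> its
  second letter. The equality cases describe 100Dc and 011Dc: \<open>b = 1\<close> with the least
  tail and \<open>b = 0\<close> with the greatest.\<close>

lemma odd_value_bounds:
  assumes "b = 0 \<or> b = (1 :: int)" "q * C \<le> x" "x \<le> q * (1 + C)"
  defines "y \<equiv> - r * real_of_int b + (1 - r) * x"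
  shows "A \<le> y" "y \<le> B" "y = A \<Longrightarrow> b = 1 \<and> x = q * C" "y = B \<Longrightarrow> b = 0 \<and> x = q * (1 + C)"
proof -
  have "0 \<le> q * C" using q C_bounds(1) by simp
  then have x: "0 \<le> (1 - r) * x" using assms(2) r by (intro mult_nonneg_nonneg) auto
  have lo: "(1 - r) * (q * C) \<le> (1 - r) * x" using assms(2) r by (intro mult_left_mono) simp_all
  have hi: "(1 - r) * x \<le> (1 - r) * (q * (1 + C))" using assms(3) r by (intro mult_left_mono) simp_all
  have y: "b = 0 \<and> y = (1 - r) * x \<or> b = 1 \<and> y = - r + (1 - r) * x"
    using assms(1) unfolding y_def by auto
  show "A \<le> y" using y lo x A_neg unfolding A_eq by (elim disjE conjE) linarith+
  show "y \<le> B" using y hi r unfolding B_eq by (elim disjE conjE) linarith+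
  show "b = 1 \<and> x = q * C" if "y = A"
  proof -
    have "b = 1 \<and> y = - r + (1 - r) * x" using y that x A_neg by (elim disjE conjE) linarith+
    moreover from this have "(1 - r) * x = (1 - r) * (q * C)" using that unfolding A_eq by linarith
    ultimately show ?thesis using r by simp
  qed
  show "b = 0 \<and> x = q * (1 + C)" if "y = B"
  proof -
    have "b = 0 \<and> y = (1 - r) * x" using y that hi r unfolding B_eq by (elim disjE conjE) linarith+
    moreover from this have "(1 - r) * x = (1 - r) * (q * (1 + C))" using that unfolding B_eq by linarith
    ultimately show ?thesis using r by simp
  qed
qed

section \<open>Values of all shifts\<close>

lemma X_bounds: "q * C \<le> X j" "X j \<le> q * (1 + C)"
  using word_series_bounds[OF q] by blast+

lemma suffix_even: "suffix (l + 2 * j) w = doubling (suffix j s)"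
  by (auto simp: w conc_def doubling_def)

lemma suffix_odd: "suffix (l + 2 * j + 1) w = [s j] \<frown> doubling (suffix (Suc j) s)"
proof
  fix n
  show "suffix (l + 2 * j + 1) w n = ([s j] \<frown> doubling (suffix (Suc j) s)) n"
    by (cases n) (simp_all add: w conc_def doubling_def)
qed

text \<open>The last letter of the initial run acts like the second letter of a pair.\<close>

lemma suffix_before: "l = Suc n \<Longrightarrow> suffix n w = [a] \<frown> doubling (suffix 0 s)"
proof
  fix i
  assume "l = Suc n"
  then show "suffix n w i = ([a] \<frown> doubling (suffix 0 s)) i"
    by (cases i) (simp_all add: w conc_def del: replicate_Suc)
qed

lemma t_even: "t (l + 2 * j) = - ((1 - r) / r) * X j"
  unfolding suffix_even by (rule word_series_doubling[OF finite_range_suffix[OF finites(1)] r])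

lemma t_odd:
  assumes "suffix n w = [b] \<frown> doubling (suffix j s)"
  shows "t n = - r * real_of_int b + (1 - r) * X j"
proof -
  have e1: "t n = - r * (real_of_int b + word_series (- r) ([] \<frown> doubling (suffix j s)))"
    unfolding assms using r finite_range_suffix[OF finites(1), of j]
    by (intro word_series_conc_Cons) (simp_all add: range_doubling)
  have e2: "word_series (- r) ([] \<frown> doubling (suffix j s)) = - ((1 - r) / r) * X j"
    unfolding conc_empty by (rule word_series_doubling[OF finite_range_suffix[OF finites(1)] r])
  show ?thesis unfolding e1 e2 using r by (simp add: field_simps)
qed

text \<open>The equality clauses decide which ends can be open and link attained endpoints to
  \<open>class_C\<close>.\<close>

definition confined_at :: "nat \<Rightarrow> bool" where
  "confined_at n \<longleftrightarrow> A \<le> t n \<and> t n \<le> B \<and>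
     (t n = A \<longrightarrow> suffix n w = [1, 0, 0] \<frown> doubling c) \<and>
     (t n = B \<longrightarrow> suffix n w = [0, 1, 1] \<frown> doubling c)"

lemma confined_at_odd:
  assumes "b = 0 \<or> b = 1" "suffix n w = [b] \<frown> doubling (suffix j s)"
  shows "confined_at n"
proof -
  note bounds = odd_value_bounds[OF assms(1) X_bounds[of j], folded t_odd[OF assms(2)]]
  have "suffix n w = [1, 0, 0] \<frown> doubling c" if "t n = A"
    using word_series_bounds(2)[OF q, of j] bounds(3)[OF that] assms(2)
    by (simp only: doubling_Cons conc_conc) simp
  moreover have "suffix n w = [0, 1, 1] \<frown> doubling c" if "t n = B"
    using word_series_bounds(4)[OF q, of j] bounds(4)[OF that] assms(2)
    by (simp only: doubling_Cons conc_conc) simp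
  ultimately show ?thesis using bounds(1,2) unfolding confined_at_def by blast
qed

text \<open>\<open>f\<close> is the value of the constant word \<open>a\<close>, so each step back
  into the run multiplies the deviation from \<open>f\<close> by \<open>- r\<close>.\<close>

lemma t_initial_run:
  assumes "k \<le> l"
  defines "f \<equiv> - r * real_of_int a / (1 + r)"
  shows "t (l - k) = f + (- r) ^ k * (t l - f)"
proof -
  let ?u = "\<lambda>_ :: nat. a"
  have "word_series (- r) ?u = f"
    using word_series_add_const[of "\<lambda>_. 0" "- r" a] r by (simp add: f_def word_series_def)
  moreover have "suffix m ?u = ?u" for m by auto
  moreover have "t (l - k) - word_series (- r) (suffix 0 ?u) =
      (- r) ^ k * (t (l - k + k) - word_series (- r) (suffix (0 + k) ?u))"
  proof (rule word_series_diff[OF finites(5)])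
    fix i assume "i < k"
    then have "l - k + i < l" using assms(1) by linarith
    then show "w (l - k + i) = a" by (simp only: w conc_fst length_replicate nth_replicate)
  qed (use r in simp_all)
  ultimately show ?thesis using assms(1) by simp
qed

lemma confined: "confined_at n"
proof -
  consider (even) j where "n = l + 2 * j" | (odd) j where "n = l + 2 * j + 1"
    | (last) "l = Suc n" | (initial) "n + 2 \<le> l"
  proof (cases "l \<le> n")
    case True
    then obtain d where d: "n = l + d" by (metis le_add_diff_inverse)
    show ?thesis
    proof (cases "even d")
      case True
      then obtain j where "d = 2 * j" by (elim evenE)
      then show ?thesis using d that(1) by blast
    next
      case False
      then obtain j where "d = 2 * j + 1" by (elim oddE)
      then show ?thesis using d that(2) by simp
    qed
  next
    case False
    then show ?thesis using that(3,4) by linarith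
  qed
  then show ?thesis
  proof cases
    case even
    then show ?thesis
      using even_value_bounds[OF X_bounds[of j], folded t_even] by (simp add: confined_at_def)
  next
    case odd
    then show ?thesis using confined_at_odd[OF letter[of j] suffix_odd[of j]] by simp
  next
    case last
    then show ?thesis by (intro confined_at_odd[OF a suffix_before])
  next
    case initial
    define f where "f = - r * real_of_int a / (1 + r)"
    define k where "k = l - n"
    have k: "n = l - k" "2 \<le> k" "k \<le> l" using initial by (simp_all add: k_def)
    have tn: "t n = f + (- r) ^ k * (t l - f)"
      unfolding k(1) f_def by (rule t_initial_run[OF k(3)])
    have f: "A < f" "f < B"
      using a A_less A_neg B_pos r by (auto simp: f_def) (smt (verit) divide_nonneg_pos)
    \<comment> \<open>A proper convex combination of \<open>y\<close> with \<open>f\<close>, which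
      lies strictly inside. For even \<open>k\<close> it is used with \<open>y = t l\<close>; for
      odd \<open>k\<close> the negative factor is absorbed by taking
      \<open>y = t (l - 1)\<close>.\<close>
    have strict: "A < f + x * (y - f) \<and> f + x * (y - f) < B"
      if "0 < x" "x < 1" "A \<le> y" "y \<le> B" for x y
    proof -
      have e: "f + x * (y - f) = (1 - x) * f + x * y" by (simp add: algebra_simps)
      have "(1 - x) * A + x * A < (1 - x) * f + x * y"
        using that f by (intro add_less_le_mono mult_strict_left_mono mult_left_mono) simp_all
      moreover have "(1 - x) * f + x * y < (1 - x) * B + x * B"
        using that f by (intro add_less_le_mono mult_strict_left_mono mult_left_mono) simp_all
      ultimately show ?thesis unfolding e by (simp add: left_diff_distrib)
    qed
    have "A < t n \<and> t n < B"
    proof (cases "even k")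
      case True
      have "A \<le> t l" "t l \<le> B"
        using even_value_bounds[OF X_bounds[of 0], folded t_even] by simp_all
      moreover have "0 < (- r) ^ k" "(- r) ^ k < 1"
        using r True k(2) by (simp_all add: power_minus_even power_less_one_iff)
      ultimately show ?thesis unfolding tn by (intro strict)
    next
      case False
      have "confined_at (l - 1)"
        using k(2,3) by (intro confined_at_odd[OF a suffix_before]) simp
      then have "A \<le> t (l - 1)" "t (l - 1) \<le> B" by (simp_all add: confined_at_def)
      moreover have "t (l - 1) = f + (- r) * (t l - f)"
        using t_initial_run[of 1] k by (simp add: f_def)
      moreover have "(- r) ^ k = r ^ (k - 1) * (- r)"
      proof -
        obtain m where m: "k = Suc m" using k(2) by (cases k) auto
        then have "even m" using False by simp
        then show ?thesis by (simp add: m power_minus_even)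
      qed
      ultimately have "t n = f + r ^ (k - 1) * (t (l - 1) - f)" unfolding tn by simp
      moreover have "0 < r ^ (k - 1)" "r ^ (k - 1) < 1"
        using r k(2) by (simp_all add: power_less_one_iff)
      ultimately show ?thesis using \<open>A \<le> t (l - 1)\<close> \<open>t (l - 1) \<le> B\<close> strict by simp
    qed
    then show ?thesis by (simp add: confined_at_def)
  qed
qed

section \<open>Approach to the endpoints\<close>

lemma prefix_approximation:
  assumes "0 < \<epsilon>"
  obtains N where "\<And>n u. range u \<subseteq> {0, 1} \<Longrightarrow> \<forall>i<N. s (n + i) = u i \<Longrightarrow> \<bar>X n - word_series q u\<bar> < \<epsilon>"
proof -
  \<comment> \<open>Two binary tails differ by at most \<open>q / (1 - q)\<close>, and
    \<open>N\<close> common letters scale this by \<open>q ^ N\<close>.\<close>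
  obtain N where "q ^ N < \<epsilon> / (q / (1 - q))"
    using real_arch_pow_inv[of "\<epsilon> / (q / (1 - q))" q] assms q by auto
  then have N: "q ^ N * (q / (1 - q)) < \<epsilon>" using q by (simp only: pos_less_divide_eq divide_pos_pos diff_gt_0_iff_gt)
  have "\<bar>X n - word_series q u\<bar> < \<epsilon>" if u: "range u \<subseteq> {0, 1}" "\<forall>i<N. s (n + i) = u i" for n u
  proof -
    have "X n - word_series q (suffix 0 u) = q ^ N * (X (n + N) - word_series q (suffix (0 + N) u))"
      using q u by (intro word_series_diff finites finite_range_binary) simp_all
    moreover have "\<bar>X (n + N) - word_series q (suffix (0 + N) u)\<bar> \<le> q / (1 - q)"
    proof -
      have "range (suffix (n + N) s) \<subseteq> {0, 1}" "range (suffix (0 + N) u) \<subseteq> {0, 1}"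
        using binary u(1) by auto
      then show ?thesis
        using word_series_binary_bounds[of "suffix (n + N) s" q]
          word_series_binary_bounds[of "suffix (0 + N) u" q] q by linarith
    qed
    then have "q ^ N * \<bar>X (n + N) - word_series q (suffix (0 + N) u)\<bar> \<le> q ^ N * (q / (1 - q))"
      using q by (intro mult_left_mono) simp_all
    ultimately show ?thesis using N by (simp add: abs_mult)
  qed
  then show ?thesis by (rule that)
qed

lemma word_series_c_Cons: "word_series q ([b] \<frown> c) = q * (real_of_int b + C)"
  using word_series_conc_Cons[OF finites(2), of q b "[]"] q by simp

lemma range_c_Cons: "b = 0 \<or> b = 1 \<Longrightarrow> range ([b] \<frown> c) \<subseteq> {0, 1}"
  using binary_c by auto

text \<open>Where a 0 of \<open>s\<close> is followed by a long prefix of 1c, the shift of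
  \<open>w\<close> from the second copy of this 0 shares a long prefix with 011Dc.\<close>

lemma approaches_B:
  assumes "0 < \<epsilon>"
  shows "\<exists>n. B - \<epsilon> < t n"
proof -
  obtain N where N: "\<And>n u. range u \<subseteq> {0, 1} \<Longrightarrow> \<forall>i<N. s (n + i) = u i \<Longrightarrow> \<bar>X n - word_series q u\<bar> < \<epsilon>"
    using prefix_approximation[OF assms] by blast
  obtain n where n: "s n = 0" "\<forall>i<N. s (Suc n + i) = ([1] \<frown> c) i" using ex_prefix_01c by blast
  have "\<bar>X (Suc n) - word_series q ([1] \<frown> c)\<bar> < \<epsilon>"
    by (rule N[OF range_c_Cons n(2)]) simp
  then have "\<bar>X (Suc n) - q * (1 + C)\<bar> < \<epsilon>" unfolding word_series_c_Cons by simp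
  then have "(1 - r) * \<bar>X (Suc n) - q * (1 + C)\<bar> < 1 * \<epsilon>"
    using r assms by (intro mult_le_less_imp_less) simp_all
  then have "\<bar>(1 - r) * X (Suc n) - B\<bar> < \<epsilon>"
    unfolding B_eq right_diff_distrib[symmetric] abs_mult using r by simp
  moreover have "t (l + 2 * n + 1) = (1 - r) * X (Suc n)" using t_odd[OF suffix_odd[of n]] n(1) by simp
  ultimately have "B - \<epsilon> < t (l + 2 * n + 1)" by linarith
  then show ?thesis by blast
qed

lemma approaches_A:
  assumes "0 < \<epsilon>"
  shows "\<exists>n. t n < A + \<epsilon>"
proof -
  obtain N where N: "\<And>n u. range u \<subseteq> {0, 1} \<Longrightarrow> \<forall>i<N. s (n + i) = u i \<Longrightarrow> \<bar>X n - word_series q u\<bar> < \<epsilon>"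
    using prefix_approximation[OF assms] by blast
  obtain n where n: "s n = 1" "\<forall>i<N. s (Suc n + i) = ([0] \<frown> c) i" using ex_prefix_10c by blast
  have "\<bar>X (Suc n) - word_series q ([0] \<frown> c)\<bar> < \<epsilon>"
    by (rule N[OF range_c_Cons n(2)]) simp
  then have "\<bar>X (Suc n) - q * C\<bar> < \<epsilon>" unfolding word_series_c_Cons by simp
  then have "(1 - r) * \<bar>X (Suc n) - q * C\<bar> < 1 * \<epsilon>"
    using r assms by (intro mult_le_less_imp_less) simp_all
  then have "\<bar>- r + (1 - r) * X (Suc n) - A\<bar> < \<epsilon>"
    unfolding A_eq add_diff_cancel_left right_diff_distrib[symmetric] abs_mult using r by simp
  moreover have "t (l + 2 * n + 1) = - r + (1 - r) * X (Suc n)" using t_odd[OF suffix_odd[of n]] n(1) by simp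
  ultimately have "t (l + 2 * n + 1) < A + \<epsilon>" by linarith
  then show ?thesis by blast
qed

text \<open>The values come arbitrarily close to both endpoints, whose distance is exactly the
  prescribed length, so the interval cannot be moved.\<close>

lemma interval_unique:
  assumes "range (\<lambda>n. h + t n) \<subseteq> {x..y}" "y - x = r + r\<^sup>2 - r ^ 3"
  shows "x = h + A" "y = h + B"
proof -
  have "x \<le> h + A"
  proof (rule field_le_epsilon)
    fix \<epsilon> :: real assume "0 < \<epsilon>"
    then obtain n where "t n < A + \<epsilon>" using approaches_A by blast
    moreover have "x \<le> h + t n" using assms(1) by (auto simp: image_subset_iff)
    ultimately show "x \<le> h + A + \<epsilon>" by linarith
  qed
  moreover have "h + B \<le> y"
  proof (rule field_le_epsilon)
    fix \<epsilon> :: real assume "0 < \<epsilon>"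
    then obtain n where "B - \<epsilon> < t n" using approaches_B by blast
    moreover have "h + t n \<le> y" using assms(1) by (auto simp: image_subset_iff)
    ultimately show "h + B \<le> y + \<epsilon>" by linarith
  qed
  ultimately show "x = h + A" "y = h + B" using assms(2) length_AB by linarith+
qed

section \<open>Slope and attained endpoints\<close>

lemma slope_w: "slope w = \<theta>"
  using range_w slope_doubling[of "replicate l a"] unfolding w by blast

text \<open>Otherwise the shifts three letters later would both be Dc. By aperiodicity the two
  positions coincide, although their letters differ.\<close>

lemma not_both_attained:
  assumes "aperiodic w"
  shows "\<not> (t i = A \<and> t j = B)"
proof
  assume "t i = A \<and> t j = B"
  then have ij: "suffix i w = [1, 0, 0] \<frown> doubling c" "suffix j w = [0, 1, 1] \<frown> doubling c"
    using confined[of i] confined[of j] by (auto simp: confined_at_def)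
  have "suffix 3 ([1, 0, 0] \<frown> doubling c) = suffix 3 ([0, 1, 1] \<frown> doubling c)"
    by (auto simp: fun_eq_iff conc_def)
  then have "suffix (i + 3) w = suffix (j + 3) w" unfolding ij[symmetric] by simp
  then have "i + 3 = j + 3" by (rule aperiodic_suffix_inj[OF assms])
  then show False using fun_cong[OF ij(1), of 0] fun_cong[OF ij(2), of 0] by simp
qed

text \<open>The definition of \<open>class_C\<close> admits any slope \<open>\<theta>'\<close>. A
  finite prefix does not affect the slope, so \<open>\<theta>'\<close> is the slope of
  \<open>w\<close>, that is \<open>\<theta>\<close>, and the shift has value \<open>A\<close> or
  \<open>B\<close>.\<close>

lemma class_C_iff:
  assumes "w \<in> class_D"
  shows "w \<in> class_C \<longleftrightarrow> (\<exists>n. t n = A \<or> t n = B)"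
proof
  assume "\<exists>n. t n = A \<or> t n = B"
  then obtain n where "suffix n w = [0, 1, 1] \<frown> doubling c \<or> suffix n w = [1, 0, 0] \<frown> doubling c"
    using confined unfolding confined_at_def by blast
  then show "w \<in> class_C" using assms \<theta> irrational unfolding class_C_def by blast
next
  assume "w \<in> class_C"
  then obtain n \<theta>' where \<theta>': "0 < \<theta>'" "\<theta>' < 1" "\<theta>' \<notin> \<rat>" and
    n: "suffix n w = [0, 1, 1] \<frown> doubling (char_word \<theta>') \<or> suffix n w = [1, 0, 0] \<frown> doubling (char_word \<theta>')"
    unfolding class_C_def by blast
  interpret c': confined_word "char_word \<theta>'" \<theta>' by (rule char_word_confined[OF \<theta>'])
  obtain ys where ys: "suffix n w = ys \<frown> doubling (char_word \<theta>')" using n by blast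
  then have "w = (prefix n w @ ys) \<frown> doubling (char_word \<theta>')"
    by (metis prefix_suffix conc_conc)
  then have "slope w = \<theta>'" using c'.slope_doubling[of "prefix n w @ ys"] range_w by simp
  then have "\<theta>' = \<theta>" using slope_w by simp
  then show "\<exists>n. t n = A \<or> t n = B" using n by (intro exI[of _ n]) auto
qed

end

section \<open>The characterization\<close>

lemma interval_with_endpoints_subset: "interval_with_endpoints a b I \<Longrightarrow> I \<subseteq> {a..b}"
  unfolding interval_with_endpoints_def by auto

lemma word_series_suffix_shift:
  assumes "finite (range w)" "0 < r" "r < 1" "\<And>i. v i = c + w i"
  shows "word_series (- r) (suffix n v) = - real_of_int c * r / (1 + r) + word_series (- r) (suffix n w)"
proof -
  have "suffix n v = (\<lambda>i. c + suffix n w i)" using assms(4) by (simp add: fun_eq_iff)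
  moreover have "word_series (- r) (\<lambda>i. c + suffix n w i) =
      real_of_int c * (- r) / (1 - (- r)) + word_series (- r) (suffix n w)"
    using assms(2,3) by (intro word_series_add_const finite_range_suffix[OF assms(1)]) simp
  ultimately show ?thesis by simp
qed

text \<open>Subtracting the smaller letter \<open>p\<close> moves all values by the same amount and
  keeps the spread; the integer sought is \<open>g = - p\<close>.\<close>

lemma class_D_of_spread:
  assumes fin: "finite (range v)" and ap: "aperiodic v" and r: "0 < r" "r < 1"
    and spread: "\<And>m n. word_series (- r) (suffix m v) - word_series (- r) (suffix n v) \<le> r + r\<^sup>2 - r ^ 3"
  shows "\<exists>g. \<exists>w \<in> class_D. \<forall>i. v i = - g + w i"
proof -
  obtain p where p: "\<And>n. v n = p \<or> v n = p + 1"
    using two_consecutive_letters[OF fin ap r spread] by blast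
  define w where "w i = v i - p" for i
  have bin: "range w \<subseteq> {0, 1}" using p by (force simp: w_def)
  have v: "v i = p + w i" for i by (simp add: w_def)
  have "narrow_word w r"
  proof
    show "range w \<subseteq> {0, 1}" by (rule bin)
    show "aperiodic w" using ap unfolding aperiodic_def w_def by simp
    show "0 < r" "r < 1" by (fact r)+
    show "word_series (- r) (suffix m w) - word_series (- r) (suffix n w) \<le> r + r\<^sup>2 - r ^ 3" for m n
      using spread[of m n] unfolding word_series_suffix_shift[OF finite_range_binary[OF bin] r v] by simp
  qed
  then have "w \<in> class_D" by (rule narrow_word.in_class_D)
  moreover have "\<forall>i. v i = - (- p) + w i" using v by simp
  ultimately show ?thesis by blast
qed

lemma class_D_doubled_word:
  assumes "w \<in> class_D" "0 < r" "r < 1"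
  obtains s \<theta> l a where "doubled_word s \<theta> r l a w"
proof -
  obtain l s where s: "sturmian s" "w = replicate l 0 \<frown> doubling s \<or> w = replicate l 1 \<frown> doubling s"
    using assms(1) unfolding class_D_def by blast
  obtain \<theta> where "confined_word s \<theta>" using sturmian_confined[OF s(1)] by blast
  then have "doubled_word s \<theta> r l a w" if "a = 0 \<or> a = 1" "w = replicate l a \<frown> doubling s" for a
    using that assms(2,3) by (intro doubled_word.intro doubled_word_axioms.intro)
  then show ?thesis using s(2) that by blast
qed

theorem theorem1p4:
  fixes v :: "int word" and r :: real
  assumes "finite (range v)" and "aperiodic v" and "0 < r" and "r < 1"
  shows "((\<exists>a b I. interval_with_endpoints a b I \<and> b - a = r + r^2 - r^3 \<and>
              range (\<lambda>n. word_series (- r) (suffix n v)) \<subseteq> I)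
            \<longleftrightarrow> (\<exists>g. \<exists>w \<in> class_D. \<forall>i. v i = - g + w i))
       \<and> (\<forall>g. \<forall>w \<in> class_D. (\<forall>i. v i = - g + w i) \<longrightarrow>
            (let \<theta> = slope w;
                 A = real_of_int g * r / (1 + r)
                       + word_series (- r) ([1, 0, 0] \<frown> doubling (char_word \<theta>));
                 B = real_of_int g * r / (1 + r)
                       + word_series (- r) ([0, 1, 1] \<frown> doubling (char_word \<theta>));
                 S = range (\<lambda>n. word_series (- r) (suffix n v))
             in (\<forall>a b I. interval_with_endpoints a b I \<and> b - a = r + r^2 - r^3 \<and> S \<subseteq> I
                    \<longrightarrow> a = A \<and> b = B)
                \<and> (S \<subseteq> {A..<B} \<or> S \<subseteq> {A<..B})
                \<and> (S \<subseteq> {A<..<B} \<longleftrightarrow> w \<notin> class_C)))"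
proof (intro conjI iffI allI ballI impI)
  let ?t = "\<lambda>n. word_series (- r) (suffix n v)"
  assume "\<exists>a b I. interval_with_endpoints a b I \<and> b - a = r + r^2 - r^3 \<and> range ?t \<subseteq> I"
  then obtain a b where ab: "b - a = r + r\<^sup>2 - r ^ 3" "range ?t \<subseteq> {a..b}"
    using interval_with_endpoints_subset by (meson order_trans)
  have t: "a \<le> ?t n" "?t n \<le> b" for n using ab(2) by (auto simp: image_subset_iff)
  show "\<exists>g. \<exists>w \<in> class_D. \<forall>i. v i = - g + w i"
  proof (rule class_D_of_spread[OF assms])
    show "?t m - ?t n \<le> r + r\<^sup>2 - r ^ 3" for m n using t[of m] t[of n] ab(1) by linarith
  qed
next
  assume "\<exists>g. \<exists>w \<in> class_D. \<forall>i. v i = - g + w i"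
  then obtain g w where wD: "w \<in> class_D" and v: "\<And>i. v i = - g + w i" by blast
  obtain s \<theta> l a where "doubled_word s \<theta> r l a w" using class_D_doubled_word[OF wD assms(3,4)] by blast
  then interpret doubled_word s \<theta> r l a w .
  \<comment> \<open>\<open>h\<close> is the value in base \<open>- r\<close> of the constant word
    with letter \<open>- g\<close>, by which all values of \<open>w\<close> are moved.\<close>
  define h where "h = real_of_int g * r / (1 + r)"
  have tv: "word_series (- r) (suffix n v) = h + t n" for n
    using word_series_suffix_shift[OF finites(5) r v] by (simp add: h_def)
  have "interval_with_endpoints (h + A) (h + B) {h + A..h + B}"
    using A_neg B_pos unfolding interval_with_endpoints_def by simp
  moreover have "(h + B) - (h + A) = r + r\<^sup>2 - r ^ 3" using length_AB by simp
  moreover have "range (\<lambda>n. word_series (- r) (suffix n v)) \<subseteq> {h + A..h + B}"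
    using confined unfolding tv confined_at_def by auto
  ultimately show "\<exists>a b I. interval_with_endpoints a b I \<and> b - a = r + r^2 - r^3 \<and>
      range (\<lambda>n. word_series (- r) (suffix n v)) \<subseteq> I" by blast
next
  fix g w
  assume wD: "w \<in> class_D" and v: "\<forall>i. v i = - g + w i"
  obtain s \<theta> l a where "doubled_word s \<theta> r l a w" using class_D_doubled_word[OF wD assms(3,4)] by blast
  then interpret doubled_word s \<theta> r l a w .
  define h where "h = real_of_int g * r / (1 + r)"
  have tv: "word_series (- r) (suffix n v) = h + t n" for n
    using word_series_suffix_shift[OF finites(5) r v[rule_format]] by (simp add: h_def)
  define S where "S = range (\<lambda>n. h + t n)"
  have ap: "aperiodic w" using assms(2) v unfolding aperiodic_def by simp
  have bounds: "A \<le> t n" "t n \<le> B" for n using confined by (simp_all add: confined_at_def)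
  have "(\<forall>a b I. interval_with_endpoints a b I \<and> b - a = r + r\<^sup>2 - r ^ 3 \<and> S \<subseteq> I \<longrightarrow> a = h + A \<and> b = h + B)"
  proof (intro allI impI)
    fix a b I
    assume I: "interval_with_endpoints a b I \<and> b - a = r + r\<^sup>2 - r ^ 3 \<and> S \<subseteq> I"
    then have "range (\<lambda>n. h + t n) \<subseteq> {a..b}"
      using interval_with_endpoints_subset unfolding S_def by blast
    then show "a = h + A \<and> b = h + B" using interval_unique I by blast
  qed
  moreover have "S \<subseteq> {h + A..<h + B} \<or> S \<subseteq> {h + A<..h + B}"
  proof (cases "\<exists>j. t j = B")
    case True
    then have "A < t n" for n using not_both_attained[OF ap] bounds(1)[of n] by (metis order_le_less)
    then show ?thesis using bounds(2) unfolding S_def by auto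
  next
    case False
    then have "t n < B" for n using bounds(2)[of n] by (metis order_le_less)
    then show ?thesis using bounds(1) unfolding S_def by auto
  qed
  moreover have "S \<subseteq> {h + A<..<h + B} \<longleftrightarrow> w \<notin> class_C"
  proof -
    have "S \<subseteq> {h + A<..<h + B} \<longleftrightarrow> (\<forall>n. A < t n \<and> t n < B)"
      unfolding S_def by (auto simp: image_subset_iff)
    also have "\<dots> \<longleftrightarrow> \<not> (\<exists>n. t n = A \<or> t n = B)" using bounds by (metis order_le_less order_less_irrefl)
    finally show ?thesis unfolding class_C_iff[OF wD] .
  qed
  ultimately show "let \<theta> = slope w;
         A = real_of_int g * r / (1 + r) + word_series (- r) ([1, 0, 0] \<frown> doubling (char_word \<theta>));
         B = real_of_int g * r / (1 + r) + word_series (- r) ([0, 1, 1] \<frown> doubling (char_word \<theta>));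
         S = range (\<lambda>n. word_series (- r) (suffix n v))
     in (\<forall>a b I. interval_with_endpoints a b I \<and> b - a = r + r^2 - r^3 \<and> S \<subseteq> I
            \<longrightarrow> a = A \<and> b = B)
        \<and> (S \<subseteq> {A..<B} \<or> S \<subseteq> {A<..B})
        \<and> (S \<subseteq> {A<..<B} \<longleftrightarrow> w \<notin> class_C)"
    unfolding Let_def slope_w tv h_def[symmetric] S_def by blast
qed

end
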